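(* Let $q,a,b,x,y,z,h$ be non-zero complex numbers with $|q|<1$ and $|q^3a^6|<|bxyz|^2$, let $\sigma\in(0,\infty)$, $w=\mathrm e^{i\psi}$. Assume there are no vanishing denominator factors and that the denominator factors in the integrand have maximum modulus less than unity, i.e. $\big|\frac\sigma a\sqrt{\frac{xyz}q}\big|$, $\big|\sigma a\sqrt{\frac q{xyz}}\big|$, $\big|a\sqrt{\frac{qx}{yz}}\big|/\sigma$, $\big|a\sqrt{\frac{qy}{xz}}\big|/\sigma$, $\big|a\sqrt{\frac{qz}{xy}}\big|/\sigma$, $\big|\frac{qa^2}{b\sqrt{xyz}}\big|/\sigma$ are all $<1$. Then $${}_{10}W_9\!\left(a^2;b^2,x,qx,y,qy,z,qz;q^2,\frac{q^3a^6}{(bxyz)^2}\right)=\frac{(q,\pm qa,x,y,z,\frac{qa^2}{xy},\frac{qa^2}{xz},\frac{qa^2}{yz};q)_\infty}{2\pi\,\vartheta(h,h\frac{xyz}{qa^2};q)\,(\pm\frac{qa}b,\frac{qa^2}x,\frac{qa^2}y,\frac{qa^2}z;q)_\infty}$$ $$\times\int_{-\pi}^{\pi}\frac{\left(\big(\frac ha\sqrt{\frac{xyz}q},\frac{qa}h\sqrt{\frac q{xyz}}\big)\frac\sigma w,\ \big(\frac ha\sqrt{\frac{xyz}q},\frac{qa}h\sqrt{\frac q{xyz}},\pm\frac{qa^2}{\sqrt{xyz}},\frac{q^{3/2}a^3}{b^2\sqrt{xyz}}\big)\frac w\sigma;q\right)_\infty}{\left(\big(\frac1a\sqrt{\frac{xyz}q},a\sqrt{\frac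 q{xyz}}\big)\frac\sigma w,\ \big(a\sqrt{\frac{qx}{yz}},a\sqrt{\frac{qy}{xz}},a\sqrt{\frac{qz}{xy}},\pm\frac{qa^2}{b\sqrt{xyz}}\big)\frac w\sigma;q\right)_\infty}\,\mathrm d\psi.$$
   Context: Notation. $(a;q)_k=\prod_{j=0}^{k-1}(1-aq^j)$, $(a;q)_\infty=\prod_{j\ge0}(1-aq^j)$, $(a_1,\dots,a_r;q)_k=\prod_j(a_j;q)_k$ for $k\in\mathbb N_0\cup\{\infty\}$. In a list, $\pm t$ stands for the two entries $t,-t$, and $(t_1,\dots,t_k)s$ stands for the entries $t_1s,\dots,t_ks$. $\vartheta(t;q)=(t,q/t;q)_\infty$ for $t\ne0$, $\vartheta(t_1,\dots,t_k;q)=\prod_j\vartheta(t_j;q)$. ${}_{r+1}\phi_r(a_1,\dots,a_{r+1};b_1,\dots,b_r;p,t)=\sum_{k\ge0}\frac{(a_1,\dots,a_{r+1};p)_k}{(p,b_1,\dots,b_r;p)_k}t^k$ for $|t|<1$. The very-well-poised series in base $p$ is $${}_{10}W_9(\alpha;a_4,\dots,a_{10};p,t)={}_{10}\phi_9\!\left(\alpha,\pm p\sqrt\alpha,a_4,\dots,a_{10};\pm\sqrt\alpha,\tfrac{p\alpha}{a_4},\dots,\tfrac{p\alpha}{a_{10}};p,t\right),$$ used here with $p=q^2$, $\alpha=a^2$. Square roots are chosen consistently: fix square roots of $q,x,y,z$ and define all half-integer powers of monomials multiplicatively from these. Convention "no vanishing denominator factors": every infinite $q$-shifted factorial and every theta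 function appearing in a denominator is non-zero, and no denominator parameter of the series makes a denominator factor vanish. *)

theory Defs
  imports "HOL-Analysis.Analysis"
begin

definition qpoch :: "complex \<Rightarrow> complex \<Rightarrow> nat \<Rightarrow> complex" where
  "qpoch a q k = (\<Prod>j<k. 1 - a * q ^ j)"

definition qpoch_inf :: "complex \<Rightarrow> complex \<Rightarrow> complex" where
  "qpoch_inf a q = (\<Prod>j. 1 - a * q ^ j)"

text \<open>Shifted factorials of several parameters; the parameters are given as a list.\<close>

definition qpochs :: "complex list \<Rightarrow> complex \<Rightarrow> nat \<Rightarrow> complex" where
  "qpochs as q k = (\<Prod>a\<leftarrow>as. qpoch a q k)"

definition qpochs_inf :: "complex list \<Rightarrow> complex \<Rightarrow> complex" where
  "qpochs_inf as q = (\<Prod>a\<leftarrow>as. qpoch_inf a q)"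

text \<open>The entries \<open>(t\<^sub>1, \<dots>, t\<^sub>k) s\<close> inside a list of parameters.\<close>

definition scaled :: "complex list \<Rightarrow> complex \<Rightarrow> complex list" where
  "scaled ts s = map (\<lambda>t. t * s) ts"

text \<open>Modified theta function, for \<open>t \<noteq> 0\<close> and \<open>norm q < 1\<close>.\<close>

definition qtheta :: "complex \<Rightarrow> complex \<Rightarrow> complex" where
  "qtheta t q = qpochs_inf [t, q / t] q"

definition qthetas :: "complex list \<Rightarrow> complex \<Rightarrow> complex" where
  "qthetas ts q = (\<Prod>t\<leftarrow>ts. qtheta t q)"

text \<open>
  The series \<open>\<^sub>r\<^sub>+\<^sub>1\<phi>\<^sub>r\<close>, intended for \<open>length as = Suc (length bs)\<close>, \<open>norm t < 1\<close> and
  non-vanishing denominators. The factor \<open>(p;p)\<^sub>k\<close> is not part of \<open>bs\<close>.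
\<close>

definition basic_hypergeometric ::
    "complex list \<Rightarrow> complex list \<Rightarrow> complex \<Rightarrow> complex \<Rightarrow> complex" where
  "basic_hypergeometric as bs p t = (\<Sum>k. qpochs as p k / qpochs (p # bs) p k * t ^ k)"

definition nonvanishing_denominators :: "complex list \<Rightarrow> complex \<Rightarrow> bool" where
  "nonvanishing_denominators bs p \<longleftrightarrow> (\<forall>k. qpochs (p # bs) p k \<noteq> 0)"

text \<open>
  Very-well-poised series with leading parameter \<open>\<alpha>\<close> and further parameters \<open>cs\<close>; the series
  \<open>\<^sub>1\<^sub>0W\<^sub>9\<close> is the case where \<open>cs\<close> has seven entries \<open>a\<^sub>4, \<dots>, a\<^sub>1\<^sub>0\<close>. Both signs of the
  square root of \<open>\<alpha>\<close> occur symmetrically, so the choice of the branch is immaterial.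
\<close>

definition vwp_upper :: "complex \<Rightarrow> complex list \<Rightarrow> complex \<Rightarrow> complex list" where
  "vwp_upper \<alpha> cs p = [\<alpha>, p * csqrt \<alpha>, - p * csqrt \<alpha>] @ cs"

definition vwp_lower :: "complex \<Rightarrow> complex list \<Rightarrow> complex \<Rightarrow> complex list" where
  "vwp_lower \<alpha> cs p = [csqrt \<alpha>, - csqrt \<alpha>] @ map (\<lambda>c. p * \<alpha> / c) cs"

definition very_well_poised :: "complex \<Rightarrow> complex list \<Rightarrow> complex \<Rightarrow> complex \<Rightarrow> complex" where
  "very_well_poised \<alpha> cs p t =
     basic_hypergeometric (vwp_upper \<alpha> cs p) (vwp_lower \<alpha> cs p) p t"

end

theory Submission
  imports Defs "HOL-Complex_Analysis.Cauchy_Integral_Formula"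
begin

text \<open>
  Put \<open>A = a\<^sup>-\<^sup>1 (x y z / q)\<^sup>1\<^sup>/\<^sup>2\<close> and \<open>u = w / \<sigma>\<close>. The pairs of theta factors in the integrand then form
  \<open>\<theta>(h A u, h A / u; q)\<close>, and the denominator is \<open>(A/u, 1/(A u), x u/A, y u/A, z u/A, s u, - s u; q)\<^sub>\<infinity>\<close>
  with \<open>s\<^sup>2 = q a\<^sup>2 / (b A)\<^sup>2\<close>. The formula is an integrated sum. The three numerator factors
  without theta functions, divided by \<open>(s u, - s u; q)\<^sub>\<infinity>\<close>, are up to a constant the product side of
  the nonterminating very-well-poised \<open>\<^sub>6\<phi>\<^sub>5\<close> sum in base \<open>q\<^sup>2\<close> with leading
  parameter \<open>a\<^sup>2\<close> and further parameters \<open>b\<^sup>2, A/u, q A/u\<close>, written without denominators that depend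
  on \<open>u\<close> (lemma \<open>weight_phi65\<close>). The condition \<open>\<bar>s u\<bar> < 1\<close> is the condition for convergence of that
  sum, which is then uniform on the circle, so that integration may be done term by term.

  The \<open>j\<close>-th term depends on \<open>u\<close> only through \<open>u\<^sup>2\<^sup>j\<close>, \<open>(A/u; q)\<^sub>2\<^sub>j\<close> and an infinite product. Because of
  the quasi-periodicity of the theta function, its product with the rest of the integrand is again an
  integrand of the same type with \<open>A\<close> replaced by \<open>A q\<^sup>2\<^sup>j\<close> in the first denominator factor
  (\<open>weight_phi65_term\<close>). Gasper's extension of the Askey-Roy integral (\<open>circle_mean_askey\<close>)
  evaluates it, and the result is the \<open>j\<close>-th term of the \<open>\<^sub>1\<^sub>0W\<^sub>9\<close> series times a constant
  (\<open>circle_mean_weight_term\<close>).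

  Both ingredients are proved by one method, without analytic continuation in the parameters. A
  contiguous relation in a single parameter \<open>e\<close> compares the values at \<open>e\<close> and at \<open>e q\<close>; it holds
  because a combination of the two summands, or of the two integrands, is a difference
  \<open>G\<^sub>k\<^sub>+\<^sub>1 - G\<^sub>k\<close>, or \<open>H(u) - H(q u)\<close>. Iteration and continuity at \<open>e = 0\<close> remove the
  parameter (\<open>phi65_remove_parameter\<close>, \<open>circle_mean_askey_remove_parameter\<close>). What is left without
  any parameters is evaluated at a special value: the sum terminates after one term, and the integral
  reduces to one residue.
\<close>

section \<open>Infinite shifted factorials and theta functions\<close>

lemma norm_mult_power_le:
  fixes x p :: complex
  assumes "norm p < 1"
  shows "norm (x * p ^ k) \<le> norm x"
proof -
  have "norm x * norm p ^ k \<le> norm x * 1"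
    using assms by (intro mult_left_mono power_le_one) auto
  then show ?thesis
    by (simp add: norm_mult norm_power)
qed

lemma convergent_prod_qpoch:
  fixes q a :: complex
  assumes "norm q < 1"
  shows "convergent_prod (\<lambda>j. 1 - a * q ^ j)"
proof -
  have "summable (\<lambda>j. norm (a * q ^ j))"
    using assms by (auto simp: norm_mult norm_power intro!: summable_mult summable_geometric)
  then have "summable (\<lambda>j. norm ((1 - a * q ^ j) - 1))"
    by simp
  then show ?thesis
    by (intro abs_convergent_prod_imp_convergent_prod) (simp add: abs_convergent_prod_conv_summable)
qed

lemma uniformly_convergent_qpoch:
  assumes "norm q < 1"
  shows "uniformly_convergent_on (cball 0 R) (\<lambda>n a. qpoch a q n)"
proof -
  have "uniformly_convergent_on (cball 0 R) (\<lambda>N a. \<Sum>n<N. norm ((1 - a * q ^ n) - 1 :: complex))"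
  proof (rule Weierstrass_m_test'[where M="\<lambda>n. R * norm q ^ n"])
    show "norm (norm ((1 - a * q ^ n) - 1 :: complex)) \<le> R * norm q ^ n" if "a \<in> cball 0 R" for n a
      using that by (auto simp: norm_mult norm_power intro!: mult_right_mono)
    show "summable (\<lambda>n. R * norm q ^ n)"
      using assms by (intro summable_mult summable_geometric) auto
  qed
  then show ?thesis
    unfolding qpoch_def
    by (intro uniformly_convergent_on_prod') (auto intro!: continuous_intros)
qed

lemma qpoch_LIMSEQ:
  assumes "norm q < 1"
  shows "(\<lambda>n. qpoch a q n) \<longlonglongrightarrow> qpoch_inf a q"
proof -
  have "(\<lambda>n. \<Prod>j<Suc n. 1 - a * q ^ j) \<longlonglongrightarrow> qpoch_inf a q"
    unfolding qpoch_inf_def lessThan_Suc_atMost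
    by (rule convergent_prod_LIMSEQ[OF convergent_prod_qpoch[OF assms]])
  then show ?thesis
    unfolding qpoch_def by (rule LIMSEQ_imp_Suc)
qed

lemma uniform_limit_qpoch_inf:
  assumes "norm q < 1"
  shows "uniform_limit (cball 0 R) (\<lambda>n a. qpoch a q n) (\<lambda>a. qpoch_inf a q) sequentially"
proof -
  obtain l where l: "uniform_limit (cball 0 R) (\<lambda>n a. qpoch a q n) l sequentially"
    using uniformly_convergent_qpoch[OF assms] by (auto simp: uniformly_convergent_on_def)
  have "l a = qpoch_inf a q" if "a \<in> cball 0 R" for a
    using tendsto_uniform_limitI[OF l that] qpoch_LIMSEQ[OF assms] LIMSEQ_unique by blast
  then show ?thesis
    using uniform_limit_cong'[of "cball 0 R" "\<lambda>n a. qpoch a q n" "\<lambda>n a. qpoch a q n" l] l by simp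
qed

lemma holomorphic_qpoch_inf_UNIV:
  assumes "norm q < 1"
  shows "(\<lambda>a. qpoch_inf a q) holomorphic_on UNIV"
proof (rule holomorphic_uniform_sequence[where f="\<lambda>n a. qpoch a q n"])
  show "(\<lambda>a. qpoch a q n) holomorphic_on UNIV" for n
    unfolding qpoch_def by (intro holomorphic_intros)
  show "\<exists>d. 0 < d \<and> cball x d \<subseteq> UNIV \<and>
      uniform_limit (cball x d) (\<lambda>n a. qpoch a q n) (\<lambda>a. qpoch_inf a q) sequentially" for x :: complex
  proof (intro exI[of _ 1] conjI)
    have "cball x 1 \<subseteq> cball 0 (norm x + 1)"
      by (simp add: cball_subset_cball_iff)
    then show "uniform_limit (cball x 1) (\<lambda>n a. qpoch a q n) (\<lambda>a. qpoch_inf a q) sequentially"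
      using uniform_limit_on_subset uniform_limit_qpoch_inf[OF assms] by blast
  qed auto
qed auto

lemma holomorphic_qpoch_inf [holomorphic_intros]:
  assumes "norm q < 1" "f holomorphic_on S"
  shows "(\<lambda>z. qpoch_inf (f z) q) holomorphic_on S"
  using holomorphic_on_compose[OF assms(2) holomorphic_on_subset[OF holomorphic_qpoch_inf_UNIV[OF assms(1)]]]
  by (simp add: o_def)

lemma tendsto_qpoch_inf [tendsto_intros]:
  assumes "norm q < 1" "(f \<longlongrightarrow> a) F"
  shows "((\<lambda>x. qpoch_inf (f x) q) \<longlongrightarrow> qpoch_inf a q) F"
proof -
  have "isCont (\<lambda>a. qpoch_inf a q) a"
    using holomorphic_on_imp_continuous_on[OF holomorphic_qpoch_inf_UNIV[OF assms(1)]]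
    by (simp add: continuous_on_eq_continuous_at)
  then show ?thesis
    using assms(2) isCont_tendsto_compose by blast
qed

lemma continuous_on_qpoch_inf [continuous_intros]:
  assumes "norm q < 1" "continuous_on S f"
  shows "continuous_on S (\<lambda>x. qpoch_inf (f x) q)"
  using assms by (auto simp: continuous_on_def intro!: tendsto_intros)

lemma qpoch_0 [simp]: "qpoch a q 0 = 1"
  by (simp add: qpoch_def)

lemma qpoch_Suc: "qpoch a q (Suc n) = qpoch a q n * (1 - a * q ^ n)"
  by (simp add: qpoch_def)

lemma qpoch_Suc_shift: "qpoch a q (Suc n) = (1 - a) * qpoch (a * q) q n"
  by (simp add: qpoch_def prod.lessThan_Suc_shift mult.assoc del: prod.lessThan_Suc)

lemma qpoch_inf_unfold:
  assumes "norm q < 1"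
  shows "qpoch_inf a q = (1 - a) * qpoch_inf (a * q) q"
proof (rule LIMSEQ_unique)
  show "(\<lambda>n. qpoch a q (Suc n)) \<longlonglongrightarrow> qpoch_inf a q"
    using qpoch_LIMSEQ[OF assms] by (rule LIMSEQ_Suc)
  show "(\<lambda>n. qpoch a q (Suc n)) \<longlonglongrightarrow> (1 - a) * qpoch_inf (a * q) q"
    unfolding qpoch_Suc_shift by (intro tendsto_intros qpoch_LIMSEQ assms)
qed

lemma qpoch_inf_split:
  assumes "norm q < 1"
  shows "qpoch_inf a q = qpoch a q n * qpoch_inf (a * q ^ n) q"
proof (induction n)
  case (Suc n)
  then show ?case
    using qpoch_inf_unfold[OF assms, of "a * q ^ n"] by (simp add: qpoch_Suc mult_ac)
qed simp

lemma qpoch_inf_0 [simp]: "qpoch_inf 0 q = 1"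
  by (simp add: qpoch_inf_def)

lemma qpoch_inf_nonzero:
  assumes "norm q < 1" "norm a < 1"
  shows "qpoch_inf a q \<noteq> 0"
proof -
  have "1 - a * q ^ j \<noteq> 0" for j
    using norm_mult_power_le[OF assms(1), of a j] assms(2) by auto
  then show ?thesis
    unfolding qpoch_inf_def by (intro prodinf_nonzero convergent_prod_qpoch[OF assms(1)])
qed

lemma qpoch_inf_square:
  assumes "norm q < 1"
  shows "qpoch_inf (a ^ 2) (q ^ 2) = qpoch_inf a q * qpoch_inf (- a) q"
proof (rule LIMSEQ_unique)
  have "norm (q ^ 2) < 1"
    using assms by (simp add: norm_power power_less_one_iff)
  then show "(\<lambda>n. qpoch (a ^ 2) (q ^ 2) n) \<longlonglongrightarrow> qpoch_inf (a ^ 2) (q ^ 2)"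
    by (rule qpoch_LIMSEQ)
  have "qpoch (a ^ 2) (q ^ 2) n = qpoch a q n * qpoch (- a) q n" for n
    unfolding qpoch_def prod.distrib[symmetric]
    by (intro prod.cong) (auto simp: algebra_simps power2_eq_square power_mult_distrib)
  then show "(\<lambda>n. qpoch (a ^ 2) (q ^ 2) n) \<longlonglongrightarrow> qpoch_inf a q * qpoch_inf (- a) q"
    by (simp only:) (intro tendsto_intros qpoch_LIMSEQ assms)
qed

lemma qpoch_double: "qpoch a q (2 * n) = qpoch a (q ^ 2) n * qpoch (a * q) (q ^ 2) n"
  by (induction n) (simp_all add: qpoch_Suc power_mult[symmetric] mult_ac)

lemma qpoch_inf_even_odd:
  assumes "norm q < 1"
  shows "qpoch_inf a q = qpoch_inf a (q ^ 2) * qpoch_inf (a * q) (q ^ 2)"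
proof (rule LIMSEQ_unique)
  have q2: "norm (q ^ 2) < 1"
    using assms by (simp add: norm_power power_less_one_iff)
  have "strict_mono (\<lambda>n::nat. 2 * n)"
    by (simp add: strict_mono_def)
  from LIMSEQ_subseq_LIMSEQ[OF qpoch_LIMSEQ[OF assms] this]
  show "(\<lambda>n. qpoch a q (2 * n)) \<longlonglongrightarrow> qpoch_inf a q"
    by (simp add: o_def)
  show "(\<lambda>n. qpoch a q (2 * n)) \<longlonglongrightarrow> qpoch_inf a (q ^ 2) * qpoch_inf (a * q) (q ^ 2)"
    unfolding qpoch_double by (intro tendsto_intros qpoch_LIMSEQ q2)
qed

lemma qtheta_eq: "qtheta t q = qpoch_inf t q * qpoch_inf (q / t) q"
  by (simp add: qtheta_def qpochs_inf_def)

lemma qtheta_mult_q: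
  assumes "norm q < 1" "q \<noteq> 0" "t \<noteq> 0"
  shows "qtheta (t * q) q = - qtheta t q / t"
proof -
  have "qtheta (t * q) q = qpoch_inf (t * q) q * ((1 - 1 / t) * qpoch_inf (q / t) q)"
    using qpoch_inf_unfold[OF assms(1), of "1 / t"] assms by (simp add: qtheta_eq)
  also have "1 - 1 / t = - (1 - t) / t"
    using assms by (simp add: field_simps)
  finally show ?thesis
    unfolding qtheta_eq qpoch_inf_unfold[OF assms(1), of t] by (simp only: mult_ac times_divide_eq_left times_divide_eq_right mult_minus_left mult_minus_right)
qed

text \<open>
  Iterated quasi-periodicity; the product over \<open>i\<close> is \<open>q\<close> to the power \<open>m (m - 1) / 2\<close>.
\<close>

lemma qtheta_mult_q_power:
  assumes "norm q < 1" "q \<noteq> 0" "t \<noteq> 0"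
  shows "qtheta t q = (- t) ^ m * (\<Prod>j<m. q ^ j) * qtheta (t * q ^ m) q"
proof (induction m)
  case (Suc m)
  have "qtheta (t * q ^ m) q = - (t * q ^ m) * qtheta (t * q ^ Suc m) q"
    using qtheta_mult_q[OF assms(1,2), of "t * q ^ m"] assms by (simp add: mult_ac)
  then show ?case
    using Suc by (simp add: mult_ac)
qed simp

lemma continuous_on_qtheta [continuous_intros]:
  assumes "norm q < 1" "continuous_on S f" "\<And>x. x \<in> S \<Longrightarrow> f x \<noteq> 0"
  shows "continuous_on S (\<lambda>x. qtheta (f x) q)"
  unfolding qtheta_eq using assms by (intro continuous_intros) auto

lemma holomorphic_qtheta [holomorphic_intros]:
  assumes "norm q < 1" "f holomorphic_on S" "\<And>x. x \<in> S \<Longrightarrow> f x \<noteq> 0"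
  shows "(\<lambda>x. qtheta (f x) q) holomorphic_on S"
  unfolding qtheta_eq using assms by (intro holomorphic_intros) auto

section \<open>The nonterminating very-well-poised 6-phi-5 sum\<close>

text \<open>
  The polynomial \<open>e\<^sup>k (1/e; p)\<^sub>k\<close>. Describing a numerator parameter by its reciprocal \<open>e\<close> makes
  the limit in which that parameter tends to infinity a continuous limit \<open>e \<rightarrow> 0\<close>.
\<close>

definition inv_qpoch :: "complex \<Rightarrow> complex \<Rightarrow> nat \<Rightarrow> complex" where
  "inv_qpoch e p k = (\<Prod>j<k. e - p ^ j)"

lemma inv_qpoch_eq: "e \<noteq> 0 \<Longrightarrow> inv_qpoch e p k = e ^ k * qpoch (1 / e) p k"
  by (induction k) (simp_all add: inv_qpoch_def qpoch_Suc field_simps)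

lemma inv_qpoch_Suc_mult_base: "inv_qpoch (p * e) p (Suc k) = p ^ k * (p * e - 1) * inv_qpoch e p k"
proof -
  have "inv_qpoch (p * e) p (Suc k) = (p * e - 1) * (\<Prod>j<k. p * (e - p ^ j))"
    by (simp add: inv_qpoch_def prod.lessThan_Suc_shift algebra_simps del: prod.lessThan_Suc)
  then show ?thesis
    by (simp add: inv_qpoch_def prod.distrib mult_ac)
qed

text \<open>
  The bound is uniform over a full disc around \<open>0\<close>: each factor \<open>e - p\<^sup>j\<close> is at most
  \<open>\<rho> + \<bar>p\<bar>\<^sup>j = \<rho> (1 + \<bar>p\<bar>\<^sup>j / \<rho>)\<close>, and the product of the second factors converges. This is why
  \<open>\<rho>\<close> has to be positive even when \<open>e = 0\<close>.
\<close>

lemma inv_qpoch_bound: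
  assumes "norm p < 1" "\<rho> > 0"
  obtains C where "C \<ge> 0"
    "\<And>k e t. norm e \<le> \<rho> \<Longrightarrow> norm t \<le> B \<Longrightarrow> norm (inv_qpoch e p k * qpoch_inf t p) \<le> C * \<rho> ^ k"
proof -
  have "compact ((\<lambda>t. qpoch_inf t p) ` cball 0 B)"
    using assms by (intro compact_continuous_image continuous_intros) auto
  then obtain D where "\<forall>s\<in>(\<lambda>t. qpoch_inf t p) ` cball 0 B. norm s \<le> D"
    using compact_imp_bounded bounded_iff by metis
  then have D: "norm t \<le> B \<Longrightarrow> norm (qpoch_inf t p) \<le> D" for t
    by simp
  define D' where "D' = max D 0"
  have D': "D' \<ge> 0" "\<And>t. norm t \<le> B \<Longrightarrow> norm (qpoch_inf t p) \<le> D'"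
    using D by (auto simp: D'_def le_max_iff_disj)
  define s where "s = (1 / (1 - norm p)) / \<rho>"
  have P: "norm (inv_qpoch e p k) \<le> exp s * \<rho> ^ k" if "norm e \<le> \<rho>" for e k
  proof -
    have "norm (inv_qpoch e p k) = (\<Prod>j<k. norm (e - p ^ j))"
      by (simp add: inv_qpoch_def prod_norm)
    also have "\<dots> \<le> (\<Prod>j<k. \<rho> * (1 + norm p ^ j / \<rho>))"
    proof (intro prod_mono conjI)
      fix j
      have "norm (e - p ^ j) \<le> norm e + norm p ^ j"
        using norm_triangle_ineq4[of e "p ^ j"] by (simp add: norm_power)
      then show "norm (e - p ^ j) \<le> \<rho> * (1 + norm p ^ j / \<rho>)"
        using that assms by (simp add: distrib_left)
    qed auto
    also have "\<dots> = \<rho> ^ k * (\<Prod>j<k. 1 + norm p ^ j / \<rho>)"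
      by (simp add: prod.distrib)
    also have "(\<Prod>j<k. 1 + norm p ^ j / \<rho>) \<le> exp (\<Sum>j<k. norm p ^ j / \<rho>)"
      using assms by (intro prod_le_exp_sum) auto
    also have "(\<Sum>j<k. norm p ^ j / \<rho>) \<le> s"
    proof -
      have "(\<Sum>j<k. norm p ^ j) \<le> (\<Sum>j. norm p ^ j)"
        using assms by (intro sum_le_suminf summable_geometric) auto
      then show ?thesis
        using assms by (simp add: s_def sum_divide_distrib[symmetric] suminf_geometric divide_right_mono del: divide_divide_eq_left)
    qed
    finally show ?thesis
      using assms by (simp add: mult_ac mult_left_mono)
  qed
  show ?thesis
  proof (rule that[of "exp s * D'"])
    show "norm (inv_qpoch e p k * qpoch_inf t p) \<le> exp s * D' * \<rho> ^ k"
      if "norm e \<le> \<rho>" "norm t \<le> B" for e t k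
    proof -
      have "norm (inv_qpoch e p k * qpoch_inf t p) \<le> (exp s * \<rho> ^ k) * D'"
        unfolding norm_mult using P[OF that(1)] D'(2)[OF that(2)] assms by (intro mult_mono) auto
      then show ?thesis
        by (simp add: mult_ac)
    qed
  qed (use D' in auto)
qed

text \<open>
  The contribution of one parameter \<open>1/e\<close> to the \<open>k\<close>-th term of the series. The denominator
  \<open>(\<alpha> p e; p)\<^sub>k\<close> has been cleared by multiplication with \<open>(\<alpha> p e; p)\<^sub>\<infinity>\<close>, so that
  every term is an entire function of \<open>e\<close>.
\<close>

definition phi65_factor :: "complex \<Rightarrow> complex \<Rightarrow> nat \<Rightarrow> complex \<Rightarrow> complex" where
  "phi65_factor \<alpha> p k e = inv_qpoch e p k * qpoch_inf (\<alpha> * e * p ^ Suc k) p"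

text \<open>
  The \<open>k\<close>-th term of the series with parameters \<open>\<alpha>; 1/\<beta>, 1/\<gamma>, 1/\<delta>\<close>, multiplied by
  \<open>(1 - \<alpha>) (\<alpha> p \<beta>, \<alpha> p \<gamma>, \<alpha> p \<delta>; p)\<^sub>\<infinity>\<close>. In this form nothing degenerates when
  \<open>\<alpha>\<close> is a power of \<open>p\<close> or a denominator parameter is exceptional.
\<close>

definition phi65_term :: "complex \<Rightarrow> complex \<Rightarrow> complex \<Rightarrow> complex \<Rightarrow> complex \<Rightarrow> nat \<Rightarrow> complex" where
  "phi65_term \<alpha> p \<beta> \<gamma> \<delta> k =
     (1 - \<alpha> * p ^ (2 * k)) * (qpoch \<alpha> p k / qpoch p p k) *
     (phi65_factor \<alpha> p k \<beta> * phi65_factor \<alpha> p k \<gamma> * phi65_factor \<alpha> p k \<delta>) * (\<alpha> * p) ^ k"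

lemma qpoch_base_nonzero: "norm p < 1 \<Longrightarrow> qpoch p p k \<noteq> 0"
  using qpoch_inf_split[of p p k] qpoch_inf_nonzero[of p p] by auto

lemma qpoch_ratio_bound:
  assumes "norm p < 1"
  obtains C where "\<And>k. norm (qpoch a p k / qpoch p p k) \<le> C"
proof -
  have "(\<lambda>k. qpoch a p k / qpoch p p k) \<longlonglongrightarrow> qpoch_inf a p / qpoch_inf p p"
    using assms by (intro tendsto_intros qpoch_LIMSEQ qpoch_inf_nonzero) auto
  then have "Bseq (\<lambda>k. qpoch a p k / qpoch p p k)"
    by (intro convergent_imp_Bseq convergentI)
  then show ?thesis
    using that by (auto simp: Bseq_def)
qed

text \<open>
  The exponents are left free in order to cover both the terms of the series and the telescoping
  certificate, which shifts some of the indices by one.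
\<close>

lemma phi65_product_bound:
  assumes p: "norm p < 1" and \<rho>: "\<rho>1 > 0" "\<rho>2 > 0" "\<rho>3 > 0"
  obtains C where "\<forall>k1 k2 k3 i1 i2 i3 \<beta> \<gamma> \<delta>. norm \<beta> \<le> \<rho>1 \<longrightarrow> norm \<gamma> \<le> \<rho>2 \<longrightarrow> norm \<delta> \<le> \<rho>3 \<longrightarrow>
     norm ((inv_qpoch \<beta> p k1 * qpoch_inf (\<alpha> * \<beta> * p ^ i1) p) *
           (inv_qpoch \<gamma> p k2 * qpoch_inf (\<alpha> * \<gamma> * p ^ i2) p) *
           (inv_qpoch \<delta> p k3 * qpoch_inf (\<alpha> * \<delta> * p ^ i3) p))
      \<le> C * (\<rho>1 ^ k1 * \<rho>2 ^ k2 * \<rho>3 ^ k3)" "C \<ge> 0"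
proof -
  obtain C1 where C1: "C1 \<ge> 0" "\<And>k e t. norm e \<le> \<rho>1 \<Longrightarrow> norm t \<le> norm \<alpha> * \<rho>1 \<Longrightarrow> norm (inv_qpoch e p k * qpoch_inf t p) \<le> C1 * \<rho>1 ^ k"
    using inv_qpoch_bound[OF p \<rho>(1), where B="norm \<alpha> * \<rho>1"] by blast
  obtain C2 where C2: "C2 \<ge> 0" "\<And>k e t. norm e \<le> \<rho>2 \<Longrightarrow> norm t \<le> norm \<alpha> * \<rho>2 \<Longrightarrow> norm (inv_qpoch e p k * qpoch_inf t p) \<le> C2 * \<rho>2 ^ k"
    using inv_qpoch_bound[OF p \<rho>(2), where B="norm \<alpha> * \<rho>2"] by blast
  obtain C3 where C3: "C3 \<ge> 0" "\<And>k e t. norm e \<le> \<rho>3 \<Longrightarrow> norm t \<le> norm \<alpha> * \<rho>3 \<Longrightarrow> norm (inv_qpoch e p k * qpoch_inf t p) \<le> C3 * \<rho>3 ^ k"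
    using inv_qpoch_bound[OF p \<rho>(3), where B="norm \<alpha> * \<rho>3"] by blast
  have le: "norm (\<alpha> * e * p ^ i) \<le> norm \<alpha> * \<rho>" if "norm e \<le> \<rho>" for e i \<rho>
    using order_trans[OF norm_mult_power_le[OF p, of "\<alpha> * e" i]] that
    by (simp add: norm_mult mult_left_mono)
  show ?thesis
  proof (rule that[of "C1 * C2 * C3"], intro allI impI)
    fix k1 k2 k3 i1 i2 i3 :: nat and \<beta> \<gamma> \<delta> :: complex
    assume b: "norm \<beta> \<le> \<rho>1" "norm \<gamma> \<le> \<rho>2" "norm \<delta> \<le> \<rho>3"
    let ?X = "inv_qpoch \<beta> p k1 * qpoch_inf (\<alpha> * \<beta> * p ^ i1) p"
    let ?Y = "inv_qpoch \<gamma> p k2 * qpoch_inf (\<alpha> * \<gamma> * p ^ i2) p"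
    let ?Z = "inv_qpoch \<delta> p k3 * qpoch_inf (\<alpha> * \<delta> * p ^ i3) p"
    have "norm (?X * ?Y * ?Z) \<le> (C1 * \<rho>1 ^ k1) * (C2 * \<rho>2 ^ k2) * (C3 * \<rho>3 ^ k3)"
      unfolding norm_mult[of "?X * ?Y" ?Z] norm_mult[of ?X ?Y]
      using b C1 C2 C3 \<rho> le by (intro mult_mono) auto
    then show "norm (?X * ?Y * ?Z) \<le> C1 * C2 * C3 * (\<rho>1 ^ k1 * \<rho>2 ^ k2 * \<rho>3 ^ k3)"
      by (simp only: mult_ac)
  qed (use C1 C2 C3 in auto)
qed

text \<open>
  A majorant that does not depend on the three parameters inside a polydisc. It yields
  summability, continuity at \<open>\<beta> = 0\<close>, and later the interchange of sum and integral.
\<close>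

lemma phi65_term_bound:
  assumes p: "norm p < 1" and \<rho>: "\<rho>1 > 0" "\<rho>2 > 0" "\<rho>3 > 0"
    and conv: "norm (\<alpha> * p) * (\<rho>1 * \<rho>2 * \<rho>3) < 1"
  obtains M where "summable M"
    "\<forall>k \<beta> \<gamma> \<delta>. norm \<beta> \<le> \<rho>1 \<longrightarrow> norm \<gamma> \<le> \<rho>2 \<longrightarrow> norm \<delta> \<le> \<rho>3 \<longrightarrow> norm (phi65_term \<alpha> p \<beta> \<gamma> \<delta> k) \<le> M k"
proof -
  obtain C where C: "\<forall>k1 k2 k3 i1 i2 i3 \<beta> \<gamma> \<delta>. norm \<beta> \<le> \<rho>1 \<longrightarrow> norm \<gamma> \<le> \<rho>2 \<longrightarrow> norm \<delta> \<le> \<rho>3 \<longrightarrow>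
     norm ((inv_qpoch \<beta> p k1 * qpoch_inf (\<alpha> * \<beta> * p ^ i1) p) *
           (inv_qpoch \<gamma> p k2 * qpoch_inf (\<alpha> * \<gamma> * p ^ i2) p) *
           (inv_qpoch \<delta> p k3 * qpoch_inf (\<alpha> * \<delta> * p ^ i3) p))
      \<le> C * (\<rho>1 ^ k1 * \<rho>2 ^ k2 * \<rho>3 ^ k3)" and C0: "C \<ge> 0"
    by (rule phi65_product_bound[OF p \<rho>, where \<alpha>=\<alpha>])
  obtain D where D: "\<And>k. norm (qpoch \<alpha> p k / qpoch p p k) \<le> D"
    using qpoch_ratio_bound[OF p, where a=\<alpha>] by blast
  have D0: "D \<ge> 0"
    using D[of 0] norm_ge_zero order_trans by blast
  let ?M = "\<lambda>k. (1 + norm \<alpha>) * D * C * (norm (\<alpha> * p) * (\<rho>1 * \<rho>2 * \<rho>3)) ^ k"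
  show ?thesis
  proof (rule that)
    show "summable ?M"
      using conv \<rho> by (intro summable_mult summable_geometric) auto
  next
    have "norm (phi65_term \<alpha> p \<beta> \<gamma> \<delta> k) \<le> ?M k"
      if b: "norm \<beta> \<le> \<rho>1" "norm \<gamma> \<le> \<rho>2" "norm \<delta> \<le> \<rho>3" for k and \<beta> \<gamma> \<delta> :: complex
    proof -
      have "norm (1 - \<alpha> * p ^ (2 * k)) \<le> 1 + norm \<alpha>"
        using norm_triangle_ineq4[of 1 "\<alpha> * p ^ (2 * k)"] norm_mult_power_le[OF p, of \<alpha> "2 * k"] by simp
      then have "norm (phi65_term \<alpha> p \<beta> \<gamma> \<delta> k)
          \<le> (1 + norm \<alpha>) * D * (C * (\<rho>1 ^ k * \<rho>2 ^ k * \<rho>3 ^ k)) * norm (\<alpha> * p) ^ k"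
        unfolding phi65_term_def phi65_factor_def
          norm_mult[of "_ * _" "(\<alpha> * p) ^ k"] norm_mult[of "_ * _" "_ * _ * _"]
          norm_mult[of "_ - _" "_ / _"] norm_power[of "\<alpha> * p"]
        using D C[rule_format, OF b, where ?k1.0=k and ?k2.0=k and ?k3.0=k and ?i1.0="Suc k" and ?i2.0="Suc k" and ?i3.0="Suc k"] C0 D0 \<rho> by (intro mult_mono) (auto simp del: power_Suc)
      then show "norm (phi65_term \<alpha> p \<beta> \<gamma> \<delta> k) \<le> ?M k"
        by (simp only: mult_ac power_mult_distrib)
    qed
    then show "\<forall>k \<beta> \<gamma> \<delta>. norm \<beta> \<le> \<rho>1 \<longrightarrow> norm \<gamma> \<le> \<rho>2 \<longrightarrow> norm \<delta> \<le> \<rho>3 \<longrightarrow> norm (phi65_term \<alpha> p \<beta> \<gamma> \<delta> k) \<le> ?M k"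
      by blast
  qed
qed

text \<open>
  Vanishing parameters are admitted in the sum, while the majorant needs positive radii.
\<close>

lemma enlarge_radii:
  fixes A b c d :: real
  assumes "A * (b * c * d) < 1" "A \<ge> 0" "b \<ge> 0" "c \<ge> 0" "d \<ge> 0"
  obtains b' c' d' where "b' > 0" "c' > 0" "d' > 0" "b \<le> b'" "c \<le> c'" "d \<le> d'" "A * (b' * c' * d') < 1"
proof -
  have "((\<lambda>\<epsilon>. A * ((b + \<epsilon>) * (c + \<epsilon>) * (d + \<epsilon>))) \<longlongrightarrow> A * ((b + 0) * (c + 0) * (d + 0))) (at_right 0)"
    by (intro tendsto_intros)
  then have "\<forall>\<^sub>F \<epsilon> in at_right 0. A * ((b + \<epsilon>) * (c + \<epsilon>) * (d + \<epsilon>)) < 1"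
    using assms by (intro order_tendstoD) auto
  moreover have "\<forall>\<^sub>F \<epsilon> in at_right (0::real). \<epsilon> > 0"
    by (simp add: eventually_at_right_less)
  ultimately have "\<forall>\<^sub>F \<epsilon> in at_right 0. \<epsilon> > 0 \<and> A * ((b + \<epsilon>) * (c + \<epsilon>) * (d + \<epsilon>)) < 1"
    by eventually_elim auto
  then obtain \<epsilon> where "\<epsilon> > 0" "A * ((b + \<epsilon>) * (c + \<epsilon>) * (d + \<epsilon>)) < 1"
    using eventually_happens trivial_limit_at_right_real by blast
  then show ?thesis
    using that[of "b + \<epsilon>" "c + \<epsilon>" "d + \<epsilon>"] assms by simp
qed

lemma summable_phi65:
  assumes p: "norm p < 1" and conv: "norm (\<alpha> * p * (\<beta> * \<gamma> * \<delta>)) < 1"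
  shows "summable (phi65_term \<alpha> p \<beta> \<gamma> \<delta>)"
proof -
  obtain b c d where bcd: "b > 0" "c > 0" "d > 0" "norm \<beta> \<le> b" "norm \<gamma> \<le> c" "norm \<delta> \<le> d"
      "norm (\<alpha> * p) * (b * c * d) < 1"
  proof (rule enlarge_radii)
    show "norm (\<alpha> * p) * (norm \<beta> * norm \<gamma> * norm \<delta>) < 1"
      using conv by (simp add: norm_mult)
  qed auto
  obtain M where M: "summable M" "\<forall>k \<beta> \<gamma> \<delta>. norm \<beta> \<le> b \<longrightarrow> norm \<gamma> \<le> c \<longrightarrow> norm \<delta> \<le> d \<longrightarrow> norm (phi65_term \<alpha> p \<beta> \<gamma> \<delta> k) \<le> M k"
    by (rule phi65_term_bound[OF p bcd(1-3,7)])
  have "norm (phi65_term \<alpha> p \<beta> \<gamma> \<delta> k) \<le> M k" for k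
    using M(2) bcd(4-6) by blast
  then show ?thesis
    by (rule summable_comparison_test'[OF M(1)])
qed

definition phi65 :: "complex \<Rightarrow> complex \<Rightarrow> complex \<Rightarrow> complex \<Rightarrow> complex \<Rightarrow> complex" where
  "phi65 \<alpha> p \<beta> \<gamma> \<delta> = (\<Sum>k. phi65_term \<alpha> p \<beta> \<gamma> \<delta> k)"

lemma phi65_commute12: "phi65 \<alpha> p \<beta> \<gamma> \<delta> = phi65 \<alpha> p \<gamma> \<beta> \<delta>"
  by (simp add: phi65_def phi65_term_def mult_ac)

lemma phi65_commute13: "phi65 \<alpha> p \<beta> \<gamma> \<delta> = phi65 \<alpha> p \<delta> \<gamma> \<beta>"
  by (simp add: phi65_def phi65_term_def mult_ac)

lemma phi65_LIMSEQ_0: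
  assumes p: "norm p < 1" and conv: "norm (\<alpha> * p * (\<beta> * \<gamma> * \<delta>)) < 1"
  shows "(\<lambda>n. phi65 \<alpha> p (\<beta> * p ^ n) \<gamma> \<delta>) \<longlonglongrightarrow> phi65 \<alpha> p 0 \<gamma> \<delta>"
proof -
  obtain b c d where bcd: "b > 0" "c > 0" "d > 0" "norm \<beta> \<le> b" "norm \<gamma> \<le> c" "norm \<delta> \<le> d"
      "norm (\<alpha> * p) * (b * c * d) < 1"
  proof (rule enlarge_radii)
    show "norm (\<alpha> * p) * (norm \<beta> * norm \<gamma> * norm \<delta>) < 1"
      using conv by (simp add: norm_mult)
  qed auto
  obtain M where M: "summable M" "\<forall>k \<beta> \<gamma> \<delta>. norm \<beta> \<le> b \<longrightarrow> norm \<gamma> \<le> c \<longrightarrow> norm \<delta> \<le> d \<longrightarrow> norm (phi65_term \<alpha> p \<beta> \<gamma> \<delta> k) \<le> M k"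
    by (rule phi65_term_bound[OF p bcd(1-3,7)])
  have "uniform_limit (cball 0 b) (\<lambda>n \<beta>. \<Sum>k<n. phi65_term \<alpha> p \<beta> \<gamma> \<delta> k) (\<lambda>\<beta>. phi65 \<alpha> p \<beta> \<gamma> \<delta>) sequentially"
    unfolding phi65_def
  proof (rule Weierstrass_m_test[OF _ M(1)])
    show "norm (phi65_term \<alpha> p e \<gamma> \<delta> k) \<le> M k" if "e \<in> cball 0 b" for k e
      using M(2) that bcd(5,6) by simp
  qed
  moreover have "continuous_on (cball 0 b) (\<lambda>\<beta>. \<Sum>k<n. phi65_term \<alpha> p \<beta> \<gamma> \<delta> k)" for n
    unfolding phi65_term_def phi65_factor_def inv_qpoch_def using p by (intro continuous_intros)
  ultimately have "continuous_on (cball 0 b) (\<lambda>\<beta>. phi65 \<alpha> p \<beta> \<gamma> \<delta>)"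
    by (intro uniform_limit_theorem[where F=sequentially]) auto
  moreover have "(\<lambda>n. \<beta> * p ^ n) \<longlonglongrightarrow> \<beta> * 0"
    using p by (intro tendsto_intros LIMSEQ_power_zero)
  moreover have "\<forall>\<^sub>F n in sequentially. \<beta> * p ^ n \<in> cball 0 b"
    using order_trans[OF norm_mult_power_le[OF p]] bcd by (intro always_eventually) auto
  ultimately show ?thesis
    using bcd by (intro continuous_on_tendsto_compose[of "cball 0 b" "\<lambda>\<beta>. phi65 \<alpha> p \<beta> \<gamma> \<delta>"]) auto
qed

text \<open>
  Closed form of the partial sums of the contiguous relation below, as in Zeilberger's method.
  The indices are shifted so that each factor divides the corresponding factors of two neighbouring
  terms; the factor \<open>- \<beta>\<close> is then read off from the limit \<open>p\<^sup>k \<rightarrow> 0\<close>.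
\<close>

definition phi65_cert :: "complex \<Rightarrow> complex \<Rightarrow> complex \<Rightarrow> complex \<Rightarrow> complex \<Rightarrow> nat \<Rightarrow> complex" where
  "phi65_cert \<alpha> p \<beta> \<gamma> \<delta> k =
     - \<beta> * \<alpha> * p * (1 - \<alpha> * p ^ k) * (qpoch \<alpha> p k / qpoch p p k) *
     ((inv_qpoch \<beta> p k * qpoch_inf (\<alpha> * \<beta> * p ^ (k + 2)) p) *
      (inv_qpoch \<gamma> p (Suc k) * qpoch_inf (\<alpha> * \<gamma> * p ^ Suc k) p) *
      (inv_qpoch \<delta> p (Suc k) * qpoch_inf (\<alpha> * \<delta> * p ^ Suc k) p)) * (\<alpha> * p) ^ k"

lemma phi65_cert_LIMSEQ_0:
  assumes p: "norm p < 1" and conv: "norm (\<alpha> * p * (\<beta> * \<gamma> * \<delta>)) < 1"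
  shows "phi65_cert \<alpha> p \<beta> \<gamma> \<delta> \<longlonglongrightarrow> 0"
proof -
  obtain b c d where bcd: "b > 0" "c > 0" "d > 0" "norm \<beta> \<le> b" "norm \<gamma> \<le> c" "norm \<delta> \<le> d"
      "norm (\<alpha> * p) * (b * c * d) < 1"
  proof (rule enlarge_radii)
    show "norm (\<alpha> * p) * (norm \<beta> * norm \<gamma> * norm \<delta>) < 1"
      using conv by (simp add: norm_mult)
  qed auto
  obtain C where C: "\<forall>k1 k2 k3 i1 i2 i3 \<beta> \<gamma> \<delta>. norm \<beta> \<le> b \<longrightarrow> norm \<gamma> \<le> c \<longrightarrow> norm \<delta> \<le> d \<longrightarrow>
     norm ((inv_qpoch \<beta> p k1 * qpoch_inf (\<alpha> * \<beta> * p ^ i1) p) *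
           (inv_qpoch \<gamma> p k2 * qpoch_inf (\<alpha> * \<gamma> * p ^ i2) p) *
           (inv_qpoch \<delta> p k3 * qpoch_inf (\<alpha> * \<delta> * p ^ i3) p))
      \<le> C * (b ^ k1 * c ^ k2 * d ^ k3)" and C0: "C \<ge> 0"
    by (rule phi65_product_bound[OF p bcd(1-3), where \<alpha>=\<alpha>])
  obtain D where D: "\<And>k. norm (qpoch \<alpha> p k / qpoch p p k) \<le> D"
    using qpoch_ratio_bound[OF p, where a=\<alpha>] by blast
  have D0: "D \<ge> 0"
    using D[of 0] norm_ge_zero order_trans by blast
  show ?thesis
  proof (rule Lim_null_comparison)
    show "(\<lambda>k. norm (- \<beta> * \<alpha> * p) * (1 + norm \<alpha>) * D * C * c * d * (norm (\<alpha> * p) * (b * c * d)) ^ k) \<longlonglongrightarrow> 0"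
      using bcd by (intro tendsto_mult_right_zero LIMSEQ_power_zero) auto
    show "\<forall>\<^sub>F k in sequentially. norm (phi65_cert \<alpha> p \<beta> \<gamma> \<delta> k)
        \<le> norm (- \<beta> * \<alpha> * p) * (1 + norm \<alpha>) * D * C * c * d * (norm (\<alpha> * p) * (b * c * d)) ^ k"
    proof (intro always_eventually allI)
      fix k
      have "norm (1 - \<alpha> * p ^ k) \<le> 1 + norm \<alpha>"
        using norm_triangle_ineq4[of 1 "\<alpha> * p ^ k"] norm_mult_power_le[OF p, of \<alpha> k] by simp
      then have "norm (phi65_cert \<alpha> p \<beta> \<gamma> \<delta> k)
          \<le> norm (- \<beta> * \<alpha> * p) * (1 + norm \<alpha>) * D * (C * (b ^ k * c ^ Suc k * d ^ Suc k)) * norm (\<alpha> * p) ^ k"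
        unfolding phi65_cert_def
          norm_mult[of "_ * _" "(\<alpha> * p) ^ k"] norm_mult[of "_ * _" "_ * _ * _"]
          norm_mult[of "_" "_ / _"] norm_mult[of "_" "_ - _"] norm_power[of "\<alpha> * p"]
        using D C[rule_format, OF bcd(4-6), where ?k1.0=k and ?k2.0="Suc k" and ?k3.0="Suc k" and ?i1.0="k + 2" and ?i2.0="Suc k" and ?i3.0="Suc k"] C0 D0 bcd by (intro mult_mono) (auto simp del: power_Suc)
      then show "norm (phi65_cert \<alpha> p \<beta> \<gamma> \<delta> k)
         \<le> norm (- \<beta> * \<alpha> * p) * (1 + norm \<alpha>) * D * C * c * d * (norm (\<alpha> * p) * (b * c * d)) ^ k"
        by (simp only: mult_ac power_mult_distrib power_Suc)
    qed
  qed
qed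

text \<open>
  After a common factor has been removed, the induction step is a polynomial identity in
  \<open>\<alpha>\<close>, \<open>\<beta>\<close>, \<open>\<gamma>\<close>, \<open>\<delta>\<close>, \<open>p\<close> and \<open>X = p\<^sup>n\<close>.
\<close>

lemma phi65_telescoping:
  assumes p: "norm p < 1"
  shows "(\<Sum>k<Suc n. (1 - \<alpha> * p * \<beta> * \<gamma> * \<delta>) * phi65_term \<alpha> p \<beta> \<gamma> \<delta> k
            - (1 - \<alpha> * p * \<beta> * \<gamma>) * (1 - \<alpha> * p * \<beta> * \<delta>) * phi65_term \<alpha> p (\<beta> * p) \<gamma> \<delta> k)
       = phi65_cert \<alpha> p \<beta> \<gamma> \<delta> n"
proof (induction n)
  case 0
  define EB EG ED where "EB = qpoch_inf (\<alpha> * \<beta> * p ^ 2) p"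
    and "EG = qpoch_inf (\<alpha> * \<gamma> * p) p" and "ED = qpoch_inf (\<alpha> * \<delta> * p) p"
  have EB: "qpoch_inf (\<alpha> * \<beta> * p) p = (1 - \<alpha> * \<beta> * p) * EB"
    using qpoch_inf_unfold[OF p, of "\<alpha> * \<beta> * p"] by (simp add: EB_def power2_eq_square mult.assoc)
  have e1: "phi65_term \<alpha> p \<beta> \<gamma> \<delta> 0 = (1 - \<alpha>) * ((1 - \<alpha> * \<beta> * p) * EB * EG * ED)"
    by (simp add: phi65_term_def phi65_factor_def inv_qpoch_def EB EG_def ED_def)
  have e2: "phi65_term \<alpha> p (\<beta> * p) \<gamma> \<delta> 0 = (1 - \<alpha>) * (EB * EG * ED)"
    by (simp add: phi65_term_def phi65_factor_def inv_qpoch_def EB_def EG_def ED_def power2_eq_square mult.assoc)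
  have e3: "phi65_cert \<alpha> p \<beta> \<gamma> \<delta> 0 = - \<beta> * \<alpha> * p * (1 - \<alpha>) * (EB * ((\<gamma> - 1) * EG) * ((\<delta> - 1) * ED))"
    by (simp add: phi65_cert_def inv_qpoch_def EB_def EG_def ED_def numeral_2_eq_2)
  show ?case
    unfolding sum.lessThan_Suc[of _ 0] lessThan_0 sum.empty e1 e2 e3 by (simp add: algebra_simps)
next
  case (Suc n)
  define X where "X = p ^ n"
  have 1: "qpoch_inf (\<alpha> * \<beta> * p ^ (n + 2)) p = (1 - \<alpha> * \<beta> * p ^ 2 * X) * qpoch_inf (\<alpha> * \<beta> * p ^ (n + 3)) p"
    using qpoch_inf_unfold[OF p, of "\<alpha> * \<beta> * p ^ (n + 2)"]
    by (simp add: X_def power_add power2_eq_square power3_eq_cube mult_ac)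
  have 2: "qpoch_inf (\<alpha> * e * p ^ Suc n) p = (1 - \<alpha> * e * p * X) * qpoch_inf (\<alpha> * e * p ^ (n + 2)) p" for e
    using qpoch_inf_unfold[OF p, of "\<alpha> * e * p ^ Suc n"]
    by (simp add: X_def power_add power2_eq_square mult_ac)
  have s1: "qpoch \<alpha> p (Suc n) = qpoch \<alpha> p n * (1 - \<alpha> * X)"
      "qpoch p p (Suc n) = qpoch p p n * (1 - p * X)"
    by (simp_all add: qpoch_Suc X_def)
  have nz: "qpoch p p n \<noteq> 0" "1 - p * X \<noteq> 0"
    using qpoch_base_nonzero[OF p, of "Suc n"] by (auto simp: s1)
  have s2: "inv_qpoch \<beta> p (Suc n) = inv_qpoch \<beta> p n * (\<beta> - X)"
    "inv_qpoch (\<beta> * p) p (Suc n) = X * (p * \<beta> - 1) * inv_qpoch \<beta> p n"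
    "inv_qpoch e p (Suc (Suc n)) = inv_qpoch e p (Suc n) * (e - p * X)" for e
    using inv_qpoch_Suc_mult_base[of p \<beta> n] by (simp_all add: inv_qpoch_def X_def mult_ac)
  define Q where "Q = qpoch \<alpha> p n / qpoch p p n"
  have Q: "qpoch \<alpha> p (Suc n) / qpoch p p (Suc n) = Q * (1 - \<alpha> * X) / (1 - p * X)"
    by (simp add: Q_def s1)
  have e1: "\<alpha> * (\<beta> * p) * p ^ (n + 2) = \<alpha> * \<beta> * p ^ (n + 3)"
    "p ^ Suc (Suc n) = p ^ (n + 2)" "Suc n + 2 = n + 3"
    by (simp_all add: power_add power2_eq_square power3_eq_cube mult_ac)
  have e2: "p ^ (2 * Suc n) = (p * X) ^ 2" "p ^ Suc n = p * X"
    using power_mult[of p "Suc n" 2] by (simp_all add: X_def mult.commute)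
  define PB PG PD where "PB = inv_qpoch \<beta> p n" and "PG = inv_qpoch \<gamma> p (Suc n)" and "PD = inv_qpoch \<delta> p (Suc n)"
  define EB EG ED where "EB = qpoch_inf (\<alpha> * \<beta> * p ^ (n + 3)) p"
    and "EG = qpoch_inf (\<alpha> * \<gamma> * p ^ (n + 2)) p" and "ED = qpoch_inf (\<alpha> * \<delta> * p ^ (n + 2)) p"
  define Y where "Y = (\<alpha> * p) ^ n"
  have Y: "(\<alpha> * p) ^ Suc n = \<alpha> * p * Y"
    by (simp add: Y_def)
  define W where "W = Q * (1 - \<alpha> * X) / (1 - p * X) * PB * EB * PG * EG * PD * ED * (\<alpha> * p * Y)"
  have t1: "phi65_term \<alpha> p \<beta> \<gamma> \<delta> (Suc n) = W * ((1 - \<alpha> * (p * X)\<^sup>2) * (\<beta> - X) * (1 - \<alpha> * \<beta> * p ^ 2 * X))"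
    unfolding phi65_term_def phi65_factor_def Q e1 1 s2 e2(1) Y PG_def[symmetric] PD_def[symmetric]
      PB_def[symmetric] EB_def[symmetric] EG_def[symmetric] ED_def[symmetric] W_def
    by (simp only: mult_ac times_divide_eq_left times_divide_eq_right)
  have t2: "phi65_term \<alpha> p (\<beta> * p) \<gamma> \<delta> (Suc n) = W * ((1 - \<alpha> * (p * X)\<^sup>2) * (X * (p * \<beta> - 1)))"
    unfolding phi65_term_def phi65_factor_def Q e1(1) s2 e2(1) Y PG_def[symmetric] PD_def[symmetric]
      PB_def[symmetric] EB_def[symmetric] e1(2) EG_def[symmetric] ED_def[symmetric] W_def
    by (simp only: mult_ac times_divide_eq_left times_divide_eq_right)
  have c1: "phi65_cert \<alpha> p \<beta> \<gamma> \<delta> (Suc n)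
     = W * (- \<beta> * \<alpha> * p * (1 - \<alpha> * (p * X)) * (\<beta> - X) * (\<gamma> - p * X) * (\<delta> - p * X))"
    unfolding phi65_cert_def Q e1(2,3) s2 Y PG_def[symmetric] PD_def[symmetric]
      PB_def[symmetric] EB_def[symmetric] EG_def[symmetric] ED_def[symmetric] W_def e2(2)
    by (simp only: mult_ac times_divide_eq_left times_divide_eq_right)
  have "phi65_cert \<alpha> p \<beta> \<gamma> \<delta> n
     = - \<beta> * \<alpha> * p * (1 - \<alpha> * X) * Q * ((PB * ((1 - \<alpha> * \<beta> * p ^ 2 * X) * EB))
       * (PG * ((1 - \<alpha> * \<gamma> * p * X) * EG)) * (PD * ((1 - \<alpha> * \<delta> * p * X) * ED))) * Y"
    unfolding phi65_cert_def 1 2 PG_def[symmetric] PD_def[symmetric] Q_def[symmetric]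
      PB_def[symmetric] EB_def[symmetric] EG_def[symmetric] ED_def[symmetric] Y_def X_def[symmetric] ..
  also have "\<dots> = W * (- \<beta> * (1 - p * X) * (1 - \<alpha> * \<beta> * p ^ 2 * X) * (1 - \<alpha> * \<gamma> * p * X) * (1 - \<alpha> * \<delta> * p * X))"
  proof -
    define R where "R = (1 - \<alpha> * \<beta> * p ^ 2 * X) * (1 - \<alpha> * \<gamma> * p * X) * (1 - \<alpha> * \<delta> * p * X)"
    define V where "V = Q * (1 - \<alpha> * X) * PB * EB * PG * EG * PD * ED * (\<alpha> * p * Y)"
    have "W * (1 - p * X) = V"
      using nz by (simp add: W_def V_def)
    then have "W * (- \<beta> * (1 - p * X) * R) = V * (- \<beta> * R)"
      by (metis mult.assoc mult.left_commute)
    then have "V * (- \<beta> * R) = W * (- \<beta> * (1 - p * X) * R)" ..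
    moreover have "- \<beta> * \<alpha> * p * (1 - \<alpha> * X) * Q * ((PB * ((1 - \<alpha> * \<beta> * p ^ 2 * X) * EB))
       * (PG * ((1 - \<alpha> * \<gamma> * p * X) * EG)) * (PD * ((1 - \<alpha> * \<delta> * p * X) * ED))) * Y = V * (- \<beta> * R)"
      by (simp add: R_def V_def mult_ac)
    ultimately show ?thesis
      by (simp only: R_def mult.assoc)
  qed
  finally have c0: "phi65_cert \<alpha> p \<beta> \<gamma> \<delta> n = W * (- \<beta> * (1 - p * X) * (1 - \<alpha> * \<beta> * p ^ 2 * X) * (1 - \<alpha> * \<gamma> * p * X) * (1 - \<alpha> * \<delta> * p * X))" .
  show ?case
  proof -
    have poly: "(1 - \<alpha> * p * \<beta> * \<gamma> * \<delta>) * ((1 - \<alpha> * (p * X)\<^sup>2) * (\<beta> - X) * (1 - \<alpha> * \<beta> * p ^ 2 * X))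
        - (1 - \<alpha> * p * \<beta> * \<gamma>) * (1 - \<alpha> * p * \<beta> * \<delta>) * ((1 - \<alpha> * (p * X)\<^sup>2) * (X * (p * \<beta> - 1)))
      = - \<beta> * \<alpha> * p * (1 - \<alpha> * (p * X)) * (\<beta> - X) * (\<gamma> - p * X) * (\<delta> - p * X)
        - (- \<beta> * (1 - p * X) * (1 - \<alpha> * \<beta> * p ^ 2 * X) * (1 - \<alpha> * \<gamma> * p * X) * (1 - \<alpha> * \<delta> * p * X))"
      by algebra
    have lin: "W * c0 + (u * (W * t1) - v * (W * t2)) = W * c1" if "u * t1 - v * t2 = c1 - c0" for u v t1 t2 c1 c0 :: complex
      using that by (simp add: right_diff_distrib[symmetric] distrib_left[symmetric] mult.left_commute[of _ W])
    show ?thesis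
      unfolding sum.lessThan_Suc[of _ "Suc n"] Suc c0 c1 t1 t2 by (rule lin[OF poly])
  qed
qed

lemma phi65_rec:
  assumes p: "norm p < 1" and conv: "norm (\<alpha> * p * (\<beta> * \<gamma> * \<delta>)) < 1"
  shows "(1 - \<alpha> * p * \<beta> * \<gamma> * \<delta>) * phi65 \<alpha> p \<beta> \<gamma> \<delta>
    = (1 - \<alpha> * p * \<beta> * \<gamma>) * (1 - \<alpha> * p * \<beta> * \<delta>) * phi65 \<alpha> p (\<beta> * p) \<gamma> \<delta>"
proof -
  have conv': "norm (\<alpha> * p * ((\<beta> * p) * \<gamma> * \<delta>)) < 1"
    using norm_mult_power_le[OF p, of "\<alpha> * p * (\<beta> * \<gamma> * \<delta>)" 1] conv by (simp add: mult_ac)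
  let ?D = "\<lambda>k. (1 - \<alpha> * p * \<beta> * \<gamma> * \<delta>) * phi65_term \<alpha> p \<beta> \<gamma> \<delta> k
            - (1 - \<alpha> * p * \<beta> * \<gamma>) * (1 - \<alpha> * p * \<beta> * \<delta>) * phi65_term \<alpha> p (\<beta> * p) \<gamma> \<delta> k"
  have "?D sums ((1 - \<alpha> * p * \<beta> * \<gamma> * \<delta>) * phi65 \<alpha> p \<beta> \<gamma> \<delta>
     - (1 - \<alpha> * p * \<beta> * \<gamma>) * (1 - \<alpha> * p * \<beta> * \<delta>) * phi65 \<alpha> p (\<beta> * p) \<gamma> \<delta>)"
    unfolding phi65_def
    by (intro sums_diff sums_mult summable_sums summable_phi65 p conv conv')
  moreover have "(\<lambda>n. \<Sum>k<Suc n. ?D k) \<longlonglongrightarrow> 0"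
    unfolding phi65_telescoping[OF p] by (rule phi65_cert_LIMSEQ_0[OF p conv])
  then have "?D sums 0"
    unfolding sums_def by (rule LIMSEQ_imp_Suc)
  ultimately show ?thesis
    by (simp add: sums_iff)
qed

text \<open>
  Iterating the contiguous relation moves \<open>\<beta>\<close> to \<open>\<beta> p\<^sup>n\<close>, and the series is continuous at \<open>0\<close>.
\<close>

lemma phi65_remove_parameter:
  assumes p: "norm p < 1" and conv: "norm (\<alpha> * p * (\<beta> * \<gamma> * \<delta>)) < 1"
  shows "qpoch_inf (\<alpha> * p * \<beta> * \<gamma> * \<delta>) p * phi65 \<alpha> p \<beta> \<gamma> \<delta>
    = qpoch_inf (\<alpha> * p * \<beta> * \<gamma>) p * qpoch_inf (\<alpha> * p * \<beta> * \<delta>) p * phi65 \<alpha> p 0 \<gamma> \<delta>"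
proof (rule LIMSEQ_unique)
  have alg: "X * u * s = Y * v * (Z * w) * t'" if "X * s = Y * Z * t" "u * t = v * w * t'"
    for X Y Z u v w s t t' :: complex
    using that by algebra
  have eq: "qpoch (\<alpha> * p * \<beta> * \<gamma> * \<delta>) p n * phi65 \<alpha> p \<beta> \<gamma> \<delta>
    = qpoch (\<alpha> * p * \<beta> * \<gamma>) p n * qpoch (\<alpha> * p * \<beta> * \<delta>) p n * phi65 \<alpha> p (\<beta> * p ^ n) \<gamma> \<delta>" for n
  proof (induction n)
    case (Suc n)
    have "norm (\<alpha> * p * ((\<beta> * p ^ n) * \<gamma> * \<delta>)) < 1"
      using norm_mult_power_le[OF p, of "\<alpha> * p * (\<beta> * \<gamma> * \<delta>)" n] conv by (simp add: mult_ac)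
    from phi65_rec[OF p this]
    have r: "(1 - \<alpha> * p * \<beta> * \<gamma> * \<delta> * p ^ n) * phi65 \<alpha> p (\<beta> * p ^ n) \<gamma> \<delta>
      = (1 - \<alpha> * p * \<beta> * \<gamma> * p ^ n) * (1 - \<alpha> * p * \<beta> * \<delta> * p ^ n) * phi65 \<alpha> p (\<beta> * p ^ Suc n) \<gamma> \<delta>"
      by (simp add: mult_ac)
    show ?case
      unfolding qpoch_Suc by (rule alg[OF Suc r])
  qed simp
  show "(\<lambda>n. qpoch (\<alpha> * p * \<beta> * \<gamma> * \<delta>) p n * phi65 \<alpha> p \<beta> \<gamma> \<delta>)
      \<longlonglongrightarrow> qpoch_inf (\<alpha> * p * \<beta> * \<gamma> * \<delta>) p * phi65 \<alpha> p \<beta> \<gamma> \<delta>"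
    by (intro tendsto_intros qpoch_LIMSEQ p)
  show "(\<lambda>n. qpoch (\<alpha> * p * \<beta> * \<gamma> * \<delta>) p n * phi65 \<alpha> p \<beta> \<gamma> \<delta>)
      \<longlonglongrightarrow> qpoch_inf (\<alpha> * p * \<beta> * \<gamma>) p * qpoch_inf (\<alpha> * p * \<beta> * \<delta>) p * phi65 \<alpha> p 0 \<gamma> \<delta>"
    unfolding eq by (intro tendsto_intros qpoch_LIMSEQ phi65_LIMSEQ_0 p conv)
qed

text \<open>
  Removing the three parameters one after the other reduces the sum to \<open>\<beta> = \<gamma> = \<delta> = 0\<close>. That
  value is found by the same reduction read backwards from \<open>\<beta> = 1\<close>, \<open>\<gamma> = \<delta> = 0\<close>: since
  \<open>1 - p\<^sup>0 = 0\<close>, only the term with \<open>k = 0\<close> survives there.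
\<close>

theorem phi65_sum:
  assumes p: "norm p < 1" and conv: "norm (\<alpha> * p * (\<beta> * \<gamma> * \<delta>)) < 1"
  shows "qpoch_inf (\<alpha> * p * \<beta> * \<gamma> * \<delta>) p * phi65 \<alpha> p \<beta> \<gamma> \<delta>
    = qpoch_inf \<alpha> p * qpoch_inf (\<alpha> * p * \<beta> * \<gamma>) p * qpoch_inf (\<alpha> * p * \<beta> * \<delta>) p * qpoch_inf (\<alpha> * p * \<gamma> * \<delta>) p"
proof -
  have z: "phi65 \<alpha> p e 0 0 = phi65 \<alpha> p 0 0 0" for e
    using phi65_remove_parameter[OF p, of \<alpha> e 0 0] by simp
  have "phi65 \<alpha> p 0 \<gamma> \<delta> = phi65 \<alpha> p \<gamma> 0 \<delta>"
    by (rule phi65_commute12)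
  also have "\<dots> = qpoch_inf (\<alpha> * p * \<gamma> * \<delta>) p * phi65 \<alpha> p 0 0 \<delta>"
    using phi65_remove_parameter[OF p, of \<alpha> \<gamma> 0 \<delta>] by simp
  also have "phi65 \<alpha> p 0 0 \<delta> = phi65 \<alpha> p \<delta> 0 0"
    by (rule phi65_commute13)
  also have "\<dots> = phi65 \<alpha> p 1 0 0"
    using z[of \<delta>] z[of 1] by simp
  also have "\<dots> = phi65_term \<alpha> p 1 0 0 0"
  proof -
    have "phi65_term \<alpha> p 1 0 0 k = 0" if "k \<noteq> 0" for k
    proof -
      have "inv_qpoch 1 p k = 0"
        unfolding inv_qpoch_def using that by (intro prod_zero) (auto intro!: bexI[of _ 0])
      then show ?thesis
        by (simp add: phi65_term_def phi65_factor_def)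
    qed
    then show ?thesis
      unfolding phi65_def by (subst suminf_finite[of "{0}"]) auto
  qed
  also have "\<dots> = qpoch_inf \<alpha> p"
    using qpoch_inf_unfold[OF p, of \<alpha>] by (simp add: phi65_term_def phi65_factor_def inv_qpoch_def)
  finally show ?thesis
    using phi65_remove_parameter[OF p conv] by (simp add: mult_ac)
qed

section \<open>Means over circles and the integral of Askey, Roy and Gasper\<close>

text \<open>
  The integral over a circle with respect to \<open>du / (2 \<pi> \<i> u)\<close>, which is invariant under dilation.
\<close>

definition circle_mean :: "real \<Rightarrow> (complex \<Rightarrow> complex) \<Rightarrow> complex" where
  "circle_mean r F = integral {- pi..pi} (\<lambda>\<psi>. F (of_real r * cis \<psi>)) / (2 * of_real pi)"

lemma circle_mean_cong:
  assumes "r > 0" "\<And>u. norm u = r \<Longrightarrow> F u = G u"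
  shows "circle_mean r F = circle_mean r G"
  unfolding circle_mean_def using assms by (simp add: norm_mult)

lemma continuous_on_circle:
  fixes F :: "complex \<Rightarrow> complex"
  assumes "r > 0" "continuous_on (sphere 0 r) F"
  shows "continuous_on A (\<lambda>\<psi>. F (of_real r * cis \<psi>))"
  using assms by (intro continuous_on_compose2[OF assms(2)] continuous_intros) (auto simp: norm_mult)

lemma integrable_on_circle:
  fixes F :: "complex \<Rightarrow> complex"
  assumes "r > 0" "continuous_on (sphere 0 r) F"
  shows "(\<lambda>\<psi>. F (of_real r * cis \<psi>)) integrable_on {- pi..pi}"
  by (rule integrable_continuous_real[OF continuous_on_circle[OF assms]])

lemma circle_mean_add:
  fixes F G :: "complex \<Rightarrow> complex"
  assumes "r > 0" "continuous_on (sphere 0 r) F" "continuous_on (sphere 0 r) G"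
  shows "circle_mean r (\<lambda>u. F u + G u) = circle_mean r F + circle_mean r G"
  using integral_add[OF integrable_on_circle[OF assms(1,2)] integrable_on_circle[OF assms(1,3)]]
  by (simp add: circle_mean_def add_divide_distrib)

lemma circle_mean_diff:
  fixes F G :: "complex \<Rightarrow> complex"
  assumes "r > 0" "continuous_on (sphere 0 r) F" "continuous_on (sphere 0 r) G"
  shows "circle_mean r (\<lambda>u. F u - G u) = circle_mean r F - circle_mean r G"
  using integral_diff[OF integrable_on_circle[OF assms(1,2)] integrable_on_circle[OF assms(1,3)]]
  by (simp add: circle_mean_def diff_divide_distrib)

lemma circle_mean_cmult: "circle_mean r (\<lambda>u. c * F u) = c * circle_mean r F"
  by (simp add: circle_mean_def)

lemma integral_shift_period:
  fixes G :: "real \<Rightarrow> complex"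
  assumes cont: "continuous_on UNIV G" and per: "\<And>x. G (x + 2 * pi) = G x"
    and \<theta>: "0 \<le> \<theta>" "\<theta> \<le> 2 * pi"
  shows "integral {- pi..pi} (\<lambda>x. G (x + \<theta>)) = integral {- pi..pi} G"
proof -
  have int: "G integrable_on {a..b}" for a b
    using cont by (intro integrable_continuous_real) (auto intro: continuous_on_subset)
  have "integral {- pi..pi} (\<lambda>x. G (x + \<theta>)) = integral {- pi + \<theta>..pi + \<theta>} G"
    using integral_shift_real_ivl[of "- pi + \<theta>" \<theta> "pi + \<theta>" G] by simp
  also have "\<dots> = integral {- pi + \<theta>..pi} G + integral {pi..pi + \<theta>} G"
    using \<theta> by (intro Henstock_Kurzweil_Integration.integral_combine[symmetric] int) auto
  also have "integral {pi..pi + \<theta>} G = integral {- pi..- pi + \<theta>} G"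
    using integral_shift_real_ivl[of pi "2 * pi" "pi + \<theta>" G] by (simp add: per)
  also have "integral {- pi + \<theta>..pi} G + integral {- pi..- pi + \<theta>} G = integral {- pi..pi} G"
    using \<theta> by (subst add.commute, intro Henstock_Kurzweil_Integration.integral_combine int) auto
  finally show ?thesis .
qed

text \<open>
  Multiplication by \<open>q\<close> scales the radius and rotates the circle; the rotation is absorbed by
  periodicity.
\<close>

lemma circle_mean_dilate:
  assumes "r > 0" "q \<noteq> 0" "continuous_on (sphere 0 (norm q * r)) F"
  shows "circle_mean r (\<lambda>u. F (q * u)) = circle_mean (norm q * r) F"
proof -
  have q: "q = of_real (norm q) * cis (Arg2pi q)"
    using Arg2pi_eq[of q] by (simp add: cis_conv_exp)
  have "q * (of_real r * cis \<psi>) = of_real (norm q * r) * cis (\<psi> + Arg2pi q)" for \<psi>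
  proof -
    have "q * (of_real r * cis \<psi>) = of_real (norm q * r) * (cis \<psi> * cis (Arg2pi q))"
      by (subst q) (simp add: mult_ac)
    then show ?thesis
      by (simp add: cis_mult)
  qed
  moreover have "integral {- pi..pi} (\<lambda>\<psi>. F (of_real (norm q * r) * cis (\<psi> + Arg2pi q)))
      = integral {- pi..pi} (\<lambda>\<psi>. F (of_real (norm q * r) * cis \<psi>))"
  proof (rule integral_shift_period)
    show "continuous_on UNIV (\<lambda>\<psi>. F (of_real (norm q * r) * cis \<psi>))"
      using assms by (intro continuous_on_circle) auto
    show "F (of_real (norm q * r) * cis (x + 2 * pi)) = F (of_real (norm q * r) * cis x)" for x
      by (simp add: cis_mult[symmetric])
  qed (use Arg2pi[of q] in auto)
  ultimately show ?thesis
    unfolding circle_mean_def by (simp only:)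
qed

text \<open>
  The angle runs over \<open>[-\<pi>, \<pi>]\<close> here and over \<open>[0, 2\<pi>]\<close> in \<^const>\<open>circlepath\<close>; the half turn
  between them turns \<open>u\<close> into \<open>-u\<close>.
\<close>

lemma circle_mean_contour:
  "circle_mean r F = contour_integral (circlepath 0 r) (\<lambda>u. F (- u) / u) / (2 * of_real pi * \<i>)" if "r > 0"
proof -
  have "integral {0 - pi..2 * pi - pi} (\<lambda>x. F (- (of_real r * cis (x + pi))))
      = integral {0..2 * pi} (\<lambda>x. F (- (of_real r * cis x)))"
    by (rule integral_shift_real_ivl)
  then have "integral {- pi..pi} (\<lambda>x. F (of_real r * cis x)) = integral {0..2 * pi} (\<lambda>x. F (- (of_real r * cis x)))"
    by (simp add: cis_mult[symmetric])
  moreover have "contour_integral (circlepath 0 r) (\<lambda>u. F (- u) / u)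
      = integral {0..2 * pi} (\<lambda>x. F (- (of_real r * cis x)) * \<i>)"
    unfolding circlepath_def using that by (subst contour_integral_part_circlepath_eq) auto
  ultimately show ?thesis
    by (simp add: circle_mean_def)
qed

lemma circle_mean_radius_independent:
  assumes r: "0 < r'" "r' \<le> r" and S: "open S" "F holomorphic_on S"
    and annulus: "\<And>u. r' \<le> norm u \<Longrightarrow> norm u \<le> r \<Longrightarrow> u \<in> S"
  shows "circle_mean r F = circle_mean r' F"
proof -
  define T where "T = {u. - u \<in> S} - {0}"
  have "open T"
    unfolding T_def using continuous_open_vimage[OF S(1), of uminus]
    by (intro open_Diff) (auto simp: vimage_def)
  moreover have "(\<lambda>u. F (- u) / u) holomorphic_on T"
  proof -
    have "(F \<circ> uminus) holomorphic_on T"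
      by (intro holomorphic_on_compose holomorphic_on_subset[OF S(2)] holomorphic_intros) (auto simp: T_def)
    then show ?thesis
      by (intro holomorphic_intros) (auto simp: T_def o_def)
  qed
  moreover have "homotopic_loops T (circlepath 0 r) (circlepath 0 r')"
  proof (rule homotopic_loops_linear)
    fix t :: real
    show "closed_segment (circlepath 0 r t) (circlepath 0 r' t) \<subseteq> T"
    proof
      fix v assume "v \<in> closed_segment (circlepath 0 r t) (circlepath 0 r' t)"
      then obtain s where s: "0 \<le> s" "s \<le> 1"
          "v = (1 - s) *\<^sub>R circlepath 0 r t + s *\<^sub>R circlepath 0 r' t"
        by (auto simp: closed_segment_def)
      define \<rho> where "\<rho> = (1 - s) * r + s * r'"
      have v: "v = of_real \<rho> * exp (2 * of_real pi * \<i> * of_real t)"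
        by (simp add: s circlepath scaleR_conv_of_real \<rho>_def algebra_simps)
      have \<rho>: "r' \<le> \<rho>" "\<rho> \<le> r"
        using s r convex_bound_le[of r r r' "1 - s" s] convex_bound_le[of "-r" "-r'" "-r'" "1 - s" s]
        by (auto simp: \<rho>_def algebra_simps)
      then have "norm v = \<rho>"
        using r by (simp add: v norm_mult norm_exp_eq_Re)
      then show "v \<in> T"
        using \<rho> r annulus[of "- v"] by (auto simp: T_def)
    qed
  qed auto
  ultimately have "contour_integral (circlepath 0 r) (\<lambda>u. F (- u) / u) = contour_integral (circlepath 0 r') (\<lambda>u. F (- u) / u)"
    by (intro Cauchy_theorem_homotopic_loops) auto
  then show ?thesis
    using r by (simp add: circle_mean_contour)
qed

lemma circle_mean_simple_pole:
  assumes "r > 0" "norm c \<noteq> r"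
  shows "circle_mean r (\<lambda>u. u / (u - c)) = (if norm c < r then 1 else 0)"
proof -
  have "contour_integral (circlepath 0 r) (\<lambda>u. - u / (- u - c) / u) = contour_integral (circlepath 0 r) (\<lambda>u. 1 / (u - (- c)))"
  proof (rule contour_integral_eq)
    fix u assume "u \<in> path_image (circlepath 0 r)"
    then have "u \<noteq> 0"
      using assms by auto
    moreover have "- u - c = - (u + c)"
      by simp
    ultimately show "- u / (- u - c) / u = 1 / (u - (- c))"
      by (simp only: minus_divide_divide) simp
  qed
  also have "\<dots> = (if norm c < r then 2 * of_real pi * \<i> else 0)"
  proof (cases "norm c < r")
    case True
    then have "((\<lambda>u. 1 / (u - (- c))) has_contour_integral 2 * of_real pi * \<i> * 1) (circlepath 0 r)"
      by (intro Cauchy_integral_circlepath_simple holomorphic_intros) auto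
    then show ?thesis
      using True by (simp add: contour_integral_unique)
  next
    case False
    have "((\<lambda>u. 1 / (u - (- c))) has_contour_integral 0) (circlepath 0 r)"
    proof (rule Cauchy_theorem_convex_simple)
      show "(\<lambda>u. 1 / (u - (- c))) holomorphic_on ball 0 (norm c)"
        by (intro holomorphic_intros) (auto simp: eq_neg_iff_add_eq_0[symmetric])
      show "path_image (circlepath 0 r) \<subseteq> ball 0 (norm c)"
        using False assms by auto
    qed auto
    then show ?thesis
      using False by (simp add: contour_integral_unique)
  qed
  finally show ?thesis
    using assms by (simp add: circle_mean_contour)
qed

text \<open>
  Subtracting the principal part leaves \<open>u\<close> times the difference quotient of \<open>g\<close> at \<open>c\<close>, which is
  holomorphic on the closed annulus, so that its means over the two circles agree.
\<close>

lemma circle_mean_residue: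
  assumes r: "0 < r'" "r' < norm c" "norm c < r" and S: "open S" "g holomorphic_on S"
    and annulus: "\<And>u. r' \<le> norm u \<Longrightarrow> norm u \<le> r \<Longrightarrow> u \<in> S"
  shows "circle_mean r (\<lambda>u. g u * (u / (u - c))) - circle_mean r' (\<lambda>u. g u * (u / (u - c))) = g c"
proof -
  define k where "k = (\<lambda>u. if u = c then deriv g c else (g u - g c) / (u - c))"
  have k: "k holomorphic_on S"
    unfolding k_def by (rule pole_lemma_open[OF S(2,1)])
  have split: "circle_mean t (\<lambda>u. g u * (u / (u - c))) = circle_mean t (\<lambda>u. u * k u) + g c * (if norm c < t then 1 else 0)"
    if t: "t = r \<or> t = r'" for t
  proof -
    have t0: "t > 0" "norm c \<noteq> t" "sphere 0 t \<subseteq> S"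
      using t r annulus by auto
    have "circle_mean t (\<lambda>u. g u * (u / (u - c))) = circle_mean t (\<lambda>u. u * k u + g c * (u / (u - c)))"
    proof (rule circle_mean_cong)
      fix u :: complex assume "norm u = t"
      then have "u - c \<noteq> 0"
        using t0 by auto
      then have "g u = g c + k u * (u - c)"
        by (simp add: k_def)
      then have "g u * (u / (u - c)) = (g c + k u * (u - c)) * (u / (u - c))"
        by simp
      then show "g u * (u / (u - c)) = u * k u + g c * (u / (u - c))"
        using \<open>u - c \<noteq> 0\<close> by (simp add: distrib_right add_divide_distrib)
    qed (use t0 in auto)
    also have "\<dots> = circle_mean t (\<lambda>u. u * k u) + circle_mean t (\<lambda>u. g c * (u / (u - c)))"
    proof (rule circle_mean_add[OF t0(1)])
      show "continuous_on (sphere 0 t) (\<lambda>u. u * k u)"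
        using k t0 by (intro continuous_intros holomorphic_on_imp_continuous_on) (auto intro: holomorphic_on_subset)
      show "continuous_on (sphere 0 t) (\<lambda>u. g c * (u / (u - c)))"
        using t0 by (intro continuous_intros) auto
    qed
    finally show ?thesis
      by (simp only: circle_mean_cmult circle_mean_simple_pole[OF t0(1,2)])
  qed
  have "circle_mean r (\<lambda>u. u * k u) = circle_mean r' (\<lambda>u. u * k u)"
    using r k by (intro circle_mean_radius_independent[OF _ _ S(1)] holomorphic_intros annulus) auto
  then show ?thesis
    using split[of r] split[of r'] r by simp
qed


text \<open>
  The Askey-Roy integrand with a third parameter in the denominator, as extended by Gasper. The
  argument of the extra numerator factor is the product of all five parameters. When \<open>u\<close> is replaced by
  \<open>q u\<close>, the theta functions contribute \<open>c d / (q u\<^sup>2)\<close>, so that the quotient of the two values is a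
  rational function of \<open>u\<close>.
\<close>

definition askey_integrand ::
    "complex \<Rightarrow> complex \<Rightarrow> complex \<Rightarrow> complex \<Rightarrow> complex \<Rightarrow> complex \<Rightarrow> complex \<Rightarrow> complex \<Rightarrow> complex" where
  "askey_integrand q h c d f1 f2 f3 u =
     qtheta (h * u / d) q * qtheta (h * c / u) q * qpoch_inf (c * d * f1 * f2 * f3 * u) q /
     (qpoch_inf (c / u) q * qpoch_inf (d / u) q *
      (qpoch_inf (f1 * u) q * qpoch_inf (f2 * u) q * qpoch_inf (f3 * u) q))"

lemma askey_integrand_swap12: "askey_integrand q h c d f1 f2 f3 = askey_integrand q h c d f2 f1 f3"
  by (rule ext) (simp add: askey_integrand_def mult_ac)

lemma askey_integrand_swap13: "askey_integrand q h c d f1 f2 f3 = askey_integrand q h c d f3 f2 f1"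
  by (rule ext) (simp add: askey_integrand_def mult_ac)

lemma qtheta_pair_dilate:
  assumes "norm q < 1" "q \<noteq> 0" "h \<noteq> 0" "c \<noteq> 0" "d \<noteq> 0" "u \<noteq> 0"
  shows "qtheta (h * (q * u) / d) q * qtheta (h * c / (q * u)) q
    = c * d / (q * u ^ 2) * (qtheta (h * u / d) q * qtheta (h * c / u) q)"
proof -
  have "qtheta (h * (q * u) / d) q = - qtheta (h * u / d) q / (h * u / d)"
    using qtheta_mult_q[of q "h * u / d"] assms by (simp add: mult_ac)
  moreover have "qtheta (h * c / (q * u)) q = - (h * c / (q * u)) * qtheta (h * c / u) q"
    using qtheta_mult_q[of q "h * c / (q * u)"] assms by (simp add: mult_ac)
  ultimately show ?thesis
    using assms by (simp add: power2_eq_square mult_ac)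
qed

text \<open>
  The circle of radius \<open>r\<close> separates the poles at \<open>c q\<^sup>k\<close> and \<open>d q\<^sup>k\<close>, which lie inside, from
  those at \<open>q\<^sup>-\<^sup>k / f\<^sub>i\<close>, which lie outside as soon as \<open>\<bar>f\<^sub>i\<bar> r < 1\<close>.
\<close>

locale askey_setup =
  fixes q h c d :: complex and r :: real
  assumes q: "norm q < 1" "q \<noteq> 0" and nz: "h \<noteq> 0" "c \<noteq> 0" "d \<noteq> 0"
    and r: "r > 0" and c: "norm c < r" and d: "norm d < r"
begin

lemma circle_nonzero:
  assumes "norm u = r"
  shows "u \<noteq> 0" "qpoch_inf (c / u) q \<noteq> 0" "qpoch_inf (d / u) q \<noteq> 0"
    "norm f * r < 1 \<Longrightarrow> qpoch_inf (f * u) q \<noteq> 0"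
  using assms r c d by (auto intro!: qpoch_inf_nonzero[OF q(1)] simp: norm_divide norm_mult)

lemma continuous_on_askey_integrand:
  assumes "norm f1 * r < 1" "norm f2 * r < 1" "norm f3 * r < 1"
  shows "continuous_on (sphere 0 r) (askey_integrand q h c d f1 f2 f3)"
  unfolding askey_integrand_def using nz assms circle_nonzero
  by (intro continuous_intros q) auto

text \<open>
  Up to the factor \<open>f\<^sub>1\<close> this is the integrand times \<open>(u - c) (u - d) / u\<close>. The two linear factors
  cancel the outermost of the inner poles, so that the function is holomorphic between the
  circles of radius \<open>\<bar>q\<bar> r\<close> and \<open>r\<close>.
\<close>

definition askey_cert :: "complex \<Rightarrow> complex \<Rightarrow> complex \<Rightarrow> complex \<Rightarrow> complex" where
  "askey_cert f1 f2 f3 u =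
     f1 * u * (qtheta (h * u / d) q * qtheta (h * c / u) q) * qpoch_inf (c * d * f1 * f2 * f3 * u) q /
     (qpoch_inf (c / u * q) q * qpoch_inf (d / u * q) q *
      (qpoch_inf (f1 * u) q * qpoch_inf (f2 * u) q * qpoch_inf (f3 * u) q))"

text \<open>
  Removing the common factor \<open>X\<close> leaves a polynomial identity in \<open>u\<close> and \<open>w = 1/u\<close>. The relation
  can be found by observing that \<open>(u - c) (u - d) (1 - F u) - c d (1 - f\<^sub>1 u) (1 - f\<^sub>2 u) (1 - f\<^sub>3 u)\<close> with
  \<open>F = c d f\<^sub>1 f\<^sub>2 f\<^sub>3\<close> has neither a constant nor a cubic term; divided by \<open>u\<close> it is linear and hence
  determined by its values at \<open>u = 1/f\<^sub>1\<close> and \<open>u = 1/F\<close>.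
\<close>

lemma askey_telescoping:
  assumes f: "norm f1 * r < 1" "norm f2 * r < 1" "norm f3 * r < 1" and u: "norm u = r"
  shows "(1 - c * f1) * (1 - d * f1) * askey_integrand q h c d f1 f2 f3 u
       - (1 - c * d * f1 * f2) * (1 - c * d * f1 * f3) * askey_integrand q h c d (f1 * q) f2 f3 u
       = askey_cert f1 f2 f3 u - askey_cert f1 f2 f3 (q * u)"
proof -
  note cn = circle_nonzero[OF u]
  define Th where "Th = qtheta (h * u / d) q * qtheta (h * c / u) q"
  define E where "E = qpoch_inf (c * d * f1 * f2 * f3 * u * q) q"
  define C D where "C = qpoch_inf (c / u) q" and "D = qpoch_inf (d / u) q"
  define G1 G2 G3 where "G1 = qpoch_inf (f1 * u) q" and "G2 = qpoch_inf (f2 * u) q" and "G3 = qpoch_inf (f3 * u) q"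
  define X where "X = Th * E / (C * D * (G1 * G2 * G3))"
  define w where "w = 1 / u"
  have w: "u * w = 1"
    using cn by (simp add: w_def)
  have nzs: "C \<noteq> 0" "D \<noteq> 0" "G1 \<noteq> 0" "G2 \<noteq> 0" "G3 \<noteq> 0"
    using cn f by (auto simp: C_def D_def G1_def G2_def G3_def)
  have F: "qpoch_inf (c * d * f1 * f2 * f3 * u) q = (1 - c * d * f1 * f2 * f3 * u) * E"
    unfolding E_def by (rule qpoch_inf_unfold[OF q(1)])
  have Cq: "C = (1 - c * w) * qpoch_inf (c / u * q) q" "D = (1 - d * w) * qpoch_inf (d / u * q) q"
    using qpoch_inf_unfold[OF q(1), of "c / u"] qpoch_inf_unfold[OF q(1), of "d / u"]
    by (simp_all add: C_def D_def w_def)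
  have Gq: "G1 = (1 - f1 * u) * qpoch_inf (f1 * u * q) q" "G2 = (1 - f2 * u) * qpoch_inf (f2 * u * q) q"
    "G3 = (1 - f3 * u) * qpoch_inf (f3 * u * q) q"
    using qpoch_inf_unfold[OF q(1), of "f1 * u"] qpoch_inf_unfold[OF q(1), of "f2 * u"]
      qpoch_inf_unfold[OF q(1), of "f3 * u"]
    by (simp_all add: G1_def G2_def G3_def)
  have "askey_integrand q h c d f1 f2 f3 u = (1 - c * d * f1 * f2 * f3 * u) * X"
    by (simp add: askey_integrand_def F X_def Th_def C_def D_def G1_def G2_def G3_def)
  moreover have "askey_integrand q h c d (f1 * q) f2 f3 u = (1 - f1 * u) * X"
  proof -
    have "askey_integrand q h c d (f1 * q) f2 f3 u
        = Th * E / (C * D * (qpoch_inf (f1 * u * q) q * G2 * G3))"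
      by (simp add: askey_integrand_def E_def Th_def C_def D_def G2_def G3_def mult_ac)
    then show ?thesis
      using nzs Gq(1) by (simp add: X_def)
  qed
  moreover have "askey_cert f1 f2 f3 u = f1 * u * (1 - c * w) * (1 - d * w) * (1 - c * d * f1 * f2 * f3 * u) * X"
  proof -
    have "askey_cert f1 f2 f3 u = f1 * u * Th * ((1 - c * d * f1 * f2 * f3 * u) * E) /
       (qpoch_inf (c / u * q) q * qpoch_inf (d / u * q) q * (G1 * G2 * G3))"
      by (simp add: askey_cert_def F Th_def G1_def G2_def G3_def)
    then show ?thesis
      using nzs unfolding Cq by (simp add: X_def Cq) (simp add: mult_ac)
  qed
  moreover have "askey_cert f1 f2 f3 (q * u) = f1 * c * d * w * (1 - f1 * u) * (1 - f2 * u) * (1 - f3 * u) * X"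
  proof -
    have "askey_cert f1 f2 f3 (q * u) = f1 * (q * u) * (c * d / (q * u ^ 2) * Th) * E /
       (C * D * (qpoch_inf (f1 * u * q) q * qpoch_inf (f2 * u * q) q * qpoch_inf (f3 * u * q) q))"
      unfolding askey_cert_def qtheta_pair_dilate[OF q nz cn(1)] using q
      by (simp add: E_def Th_def C_def D_def mult_ac)
    also have "\<dots> = f1 * c * d * w * Th * E /
       (C * D * (qpoch_inf (f1 * u * q) q * qpoch_inf (f2 * u * q) q * qpoch_inf (f3 * u * q) q))"
      using q cn(1) by (simp add: w_def power2_eq_square)
    finally show ?thesis
      using nzs by (simp add: X_def Gq) (simp add: mult_ac)
  qed
  moreover have "(1 - c * f1) * (1 - d * f1) * ((1 - c * d * f1 * f2 * f3 * u) * X)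
       - (1 - c * d * f1 * f2) * (1 - c * d * f1 * f3) * ((1 - f1 * u) * X)
     = f1 * u * (1 - c * w) * (1 - d * w) * (1 - c * d * f1 * f2 * f3 * u) * X
      - f1 * c * d * w * (1 - f1 * u) * (1 - f2 * u) * (1 - f3 * u) * X"
    using w by algebra
  ultimately show ?thesis
    by simp
qed

lemma norm_mult_q_less:
  assumes "norm f * r < 1"
  shows "norm (f * q ^ n) * r < 1"
proof -
  have "norm (f * q ^ n) * r \<le> norm f * r"
    using r by (intro mult_right_mono norm_mult_power_le[OF q(1)]) auto
  then show ?thesis
    using assms by simp
qed

lemma norm_mult_q_inner:
  assumes "norm e < r"
  shows "norm (e * q) < norm q * r"
proof -
  have "norm q * norm e < norm q * r"
    using assms q by (intro mult_strict_left_mono) auto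
  then show ?thesis
    by (simp add: norm_mult mult.commute[of "norm e"] del: mult_less_cancel_left)
qed

text \<open>
  The mean of the right-hand side of the telescoping identity vanishes: its two parts are means of
  one function, holomorphic in between, over the circles of radius \<open>r\<close> and \<open>\<bar>q\<bar> r\<close>.
\<close>

lemma circle_mean_askey_rec:
  assumes f: "norm f1 * r < 1" "norm f2 * r < 1" "norm f3 * r < 1"
  shows "(1 - c * f1) * (1 - d * f1) * circle_mean r (askey_integrand q h c d f1 f2 f3)
       = (1 - c * d * f1 * f2) * (1 - c * d * f1 * f3) * circle_mean r (askey_integrand q h c d (f1 * q) f2 f3)"
proof -
  have f1q: "norm (f1 * q) * r < 1"
    using norm_mult_q_less[OF f(1), of 1] by simp
  define S :: "complex set" where "S = {u. u \<noteq> 0 \<and> norm (c * q) < norm u \<and> norm (d * q) < norm u \<and>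
     norm (f1 * u) < 1 \<and> norm (f2 * u) < 1 \<and> norm (f3 * u) < 1}"
  have S: "open S"
    unfolding S_def by (intro open_Collect_conj open_Collect_neq open_Collect_less continuous_intros)
  have hol: "askey_cert f1 f2 f3 holomorphic_on S"
    unfolding askey_cert_def
  proof (intro holomorphic_intros q)
    fix u assume u: "u \<in> S"
    then show "qpoch_inf (c / u * q) q * qpoch_inf (d / u * q) q *
           (qpoch_inf (f1 * u) q * qpoch_inf (f2 * u) q * qpoch_inf (f3 * u) q) \<noteq> 0"
      by (auto simp: S_def norm_divide norm_mult qpoch_inf_nonzero[OF q(1)])
  qed (use nz in \<open>auto simp: S_def\<close>)
  have annulus: "u \<in> S" if "norm q * r \<le> norm u" "norm u \<le> r" for u
  proof -
    have "norm (f * u) < 1" if "norm f * r < 1" for f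
      using mult_left_mono[OF \<open>norm u \<le> r\<close>, of "norm f"] that by (simp add: norm_mult)
    moreover have "norm (e * q) < norm u" if "norm e < r" for e
      using norm_mult_q_inner[OF that] \<open>norm q * r \<le> norm u\<close> by linarith
    moreover have "u \<noteq> 0"
      using that q r by (auto simp: mult_le_0_iff)
    ultimately show ?thesis
      using f c d by (auto simp: S_def)
  qed
  have qr: "0 < norm q * r" "norm q * r \<le> r"
    using q r by (auto simp: mult_le_cancel_right1)
  have cont: "continuous_on (sphere 0 t) (askey_cert f1 f2 f3)" if "norm q * r \<le> t" "t \<le> r" for t
    using that annulus by (intro continuous_on_subset[OF holomorphic_on_imp_continuous_on[OF hol]]) auto
  have contq: "continuous_on (sphere 0 r) (\<lambda>u. askey_cert f1 f2 f3 (q * u))"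
    using qr by (intro continuous_on_compose2[OF cont[of "norm q * r"]] continuous_intros) (auto simp: norm_mult)
  have "circle_mean r (\<lambda>u. askey_cert f1 f2 f3 u - askey_cert f1 f2 f3 (q * u)) =
      circle_mean r (askey_cert f1 f2 f3) - circle_mean (norm q * r) (askey_cert f1 f2 f3)"
    using qr q r by (simp add: circle_mean_diff[OF r cont contq] circle_mean_dilate cont)
  also have "\<dots> = 0"
    using circle_mean_radius_independent[OF qr S hol annulus] by simp
  finally have "circle_mean r (\<lambda>u. (1 - c * f1) * (1 - d * f1) * askey_integrand q h c d f1 f2 f3 u
       - (1 - c * d * f1 * f2) * (1 - c * d * f1 * f3) * askey_integrand q h c d (f1 * q) f2 f3 u) = 0"
    using circle_mean_cong[OF r askey_telescoping[OF f]] by simp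
  moreover have "continuous_on (sphere 0 r) (\<lambda>u. (1 - c * f1) * (1 - d * f1) * askey_integrand q h c d f1 f2 f3 u)"
    "continuous_on (sphere 0 r) (\<lambda>u. (1 - c * d * f1 * f2) * (1 - c * d * f1 * f3) * askey_integrand q h c d (f1 * q) f2 f3 u)"
    using f f1q by (auto intro!: continuous_intros continuous_on_askey_integrand)
  ultimately show ?thesis
    by (simp add: circle_mean_diff[OF r] circle_mean_cmult)
qed

lemma circle_mean_askey_LIMSEQ:
  assumes f: "norm f1 * r < 1" "norm f2 * r < 1" "norm f3 * r < 1"
  shows "(\<lambda>n. circle_mean r (askey_integrand q h c d (f1 * q ^ n) f2 f3))
     \<longlonglongrightarrow> circle_mean r (askey_integrand q h c d 0 f2 f3)"
proof -
  let ?U = "cball (0::complex) (norm f1)"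
  have "continuous_on (?U \<times> cbox (- pi) pi) (\<lambda>(f, \<psi>). askey_integrand q h c d f f2 f3 (of_real r * cis \<psi>))"
  proof -
    have den: "qpoch_inf (c / (of_real r * cis (snd p))) q * qpoch_inf (d / (of_real r * cis (snd p))) q *
         (qpoch_inf (fst p * (of_real r * cis (snd p))) q * qpoch_inf (f2 * (of_real r * cis (snd p))) q *
          qpoch_inf (f3 * (of_real r * cis (snd p))) q) \<noteq> 0"
      if "p \<in> ?U \<times> cbox (- pi) pi" for p
    proof -
      have "norm (fst p) * r \<le> norm f1 * r"
        using that r by (auto intro!: mult_right_mono)
      then have "norm (fst p) * r < 1"
        using f(1) by linarith
      then show ?thesis
        using circle_nonzero[of "of_real r * cis (snd p)"] f r by (auto simp: norm_mult)
    qed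
    show ?thesis
      unfolding askey_integrand_def case_prod_unfold
      by (intro continuous_intros q) (use den nz r in auto)
  qed
  then have "continuous_on ?U (\<lambda>f. circle_mean r (askey_integrand q h c d f f2 f3))"
    unfolding circle_mean_def box_real[symmetric]
    by (intro continuous_intros integral_continuous_on_param) auto
  moreover have "(\<lambda>n. f1 * q ^ n) \<longlonglongrightarrow> f1 * 0"
    using q by (intro tendsto_intros LIMSEQ_power_zero) auto
  moreover have "norm (f1 * q ^ n) \<le> norm f1" for n
    by (rule norm_mult_power_le[OF q(1)])
  ultimately show ?thesis
    by (intro continuous_on_tendsto_compose[of ?U "\<lambda>f. circle_mean r (askey_integrand q h c d f f2 f3)"]) auto
qed

lemma circle_mean_askey_remove_parameter:
  assumes f: "norm f1 * r < 1" "norm f2 * r < 1" "norm f3 * r < 1"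
  shows "qpoch_inf (c * f1) q * qpoch_inf (d * f1) q * circle_mean r (askey_integrand q h c d f1 f2 f3)
       = qpoch_inf (c * d * f1 * f2) q * qpoch_inf (c * d * f1 * f3) q * circle_mean r (askey_integrand q h c d 0 f2 f3)"
proof (rule LIMSEQ_unique)
  have alg: "X * u * (X' * u') * s = Y * v * (Z * w) * t'" if "X * X' * s = Y * Z * t" "u * u' * t = v * w * t'"
    for X X' Y Z u u' v w s t t' :: complex
    using that by algebra
  have eq: "qpoch (c * f1) q n * qpoch (d * f1) q n * circle_mean r (askey_integrand q h c d f1 f2 f3)
    = qpoch (c * d * f1 * f2) q n * qpoch (c * d * f1 * f3) q n * circle_mean r (askey_integrand q h c d (f1 * q ^ n) f2 f3)" for n
  proof (induction n)
    case (Suc n)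
    have "(1 - c * f1 * q ^ n) * (1 - d * f1 * q ^ n) * circle_mean r (askey_integrand q h c d (f1 * q ^ n) f2 f3)
       = (1 - c * d * f1 * f2 * q ^ n) * (1 - c * d * f1 * f3 * q ^ n) * circle_mean r (askey_integrand q h c d (f1 * q ^ Suc n) f2 f3)"
      using circle_mean_askey_rec[OF norm_mult_q_less[OF f(1), of n] f(2,3)] by (simp add: mult_ac)
    then show ?case
      unfolding qpoch_Suc by (rule alg[OF Suc])
  qed simp
  show "(\<lambda>n. qpoch (c * f1) q n * qpoch (d * f1) q n * circle_mean r (askey_integrand q h c d f1 f2 f3))
      \<longlonglongrightarrow> qpoch_inf (c * f1) q * qpoch_inf (d * f1) q * circle_mean r (askey_integrand q h c d f1 f2 f3)"
    by (intro tendsto_intros qpoch_LIMSEQ q)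
  show "(\<lambda>n. qpoch (c * f1) q n * qpoch (d * f1) q n * circle_mean r (askey_integrand q h c d f1 f2 f3))
      \<longlonglongrightarrow> qpoch_inf (c * d * f1 * f2) q * qpoch_inf (c * d * f1 * f3) q * circle_mean r (askey_integrand q h c d 0 f2 f3)"
    unfolding eq by (intro tendsto_intros qpoch_LIMSEQ circle_mean_askey_LIMSEQ q f)
qed

text \<open>
  The parameter \<open>f\<^sub>1 = 1/c\<close> would put a pole at \<open>u = c\<close>. The first step of the recursion is still
  meaningful there if the left-hand side is replaced by the residue at \<open>c\<close>, and it evaluates the
  integral with \<open>f\<^sub>1 = q/c\<close>, \<open>f\<^sub>2 = f\<^sub>3 = 0\<close>. Removing this parameter gives the integral without any.
  The hypothesis places \<open>c\<close> between the circles of radius \<open>\<bar>q\<bar> r\<close> and \<open>r\<close>.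
\<close>

lemma circle_mean_askey_base_aux:
  assumes rc: "norm q * r < norm c"
  shows "circle_mean r (askey_integrand q h c d 0 0 0) = qtheta h q * qtheta (h * c / d) q / qpoch_inf q q"
proof -
  define g where "g u = qtheta (h * u / d) q * qtheta (h * c / u) q /
     (qpoch_inf (c / u * q) q * qpoch_inf (d / u * q) q * qpoch_inf (u / c * q) q)" for u
  (* Up to sign, H is the certificate with f1 = 1/c and f2 = f3 = 0, whose simple
     pole at c is the zero of (u/c; q) in the denominator. *)
  define H where "H u = g u * (u / (u - c))" for u
  define S :: "complex set" where "S = {u. u \<noteq> 0 \<and> norm (c * q) < norm u \<and> norm (d * q) < norm u \<and> norm (u * q) < norm c}"
  have S: "open S"
    unfolding S_def by (intro open_Collect_conj open_Collect_neq open_Collect_less continuous_intros)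
  have hol: "g holomorphic_on S"
    unfolding g_def
  proof (intro holomorphic_intros q)
    fix u assume u: "u \<in> S"
    then show "qpoch_inf (c / u * q) q * qpoch_inf (d / u * q) q * qpoch_inf (u / c * q) q \<noteq> 0"
      using nz by (auto simp: S_def norm_divide norm_mult qpoch_inf_nonzero[OF q(1)])
  qed (use nz in \<open>auto simp: S_def\<close>)
  have annulus: "u \<in> S" if "norm q * r \<le> norm u" "norm u \<le> r" for u
  proof -
    have "norm (e * q) < norm u" if "norm e < r" for e
      using norm_mult_q_inner[OF that] \<open>norm q * r \<le> norm u\<close> by linarith
    moreover have "norm (u * q) < norm c"
      using mult_left_mono[OF \<open>norm u \<le> r\<close>, of "norm q"] rc by (simp add: norm_mult mult.commute)
    moreover have "u \<noteq> 0"
      using that q r by (auto simp: mult_le_0_iff)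
    ultimately show ?thesis
      using c d by (auto simp: S_def)
  qed
  have qr: "0 < norm q * r" "norm q * r \<le> r"
    using q r by (auto simp: mult_le_cancel_right1)
  have cont: "continuous_on (sphere 0 t) H" if "norm q * r \<le> t" "t \<le> r" "t \<noteq> norm c" for t
    unfolding H_def using that annulus
    by (intro continuous_intros continuous_on_subset[OF holomorphic_on_imp_continuous_on[OF hol]]) auto
  have contq: "continuous_on (sphere 0 r) (\<lambda>u. H (q * u))"
    using qr rc by (intro continuous_on_compose2[OF cont[of "norm q * r"]] continuous_intros) (auto simp: norm_mult)
  have eq: "askey_integrand q h c d (q / c) 0 0 u = H u - H (q * u)" if u: "norm u = r" for u
  proof -
    note cn = circle_nonzero[OF u]
    define Th where "Th = qtheta (h * u / d) q * qtheta (h * c / u) q"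
    define C D G where "C = qpoch_inf (c / u) q" and "D = qpoch_inf (d / u) q" and "G = qpoch_inf (u / c * q) q"
    define X where "X = Th / (C * D * G)"
    have uc: "u \<noteq> c" "q * u \<noteq> c"
      using u c rc by (auto simp: norm_mult)
    have nzs: "C \<noteq> 0" "D \<noteq> 0" "G \<noteq> 0"
      using cn rc u nz by (auto simp: C_def D_def G_def norm_mult norm_divide mult.commute intro!: qpoch_inf_nonzero[OF q(1)])
    have Cq: "C = (1 - c / u) * qpoch_inf (c / u * q) q" "D = (1 - d / u) * qpoch_inf (d / u * q) q"
      unfolding C_def D_def by (rule qpoch_inf_unfold[OF q(1)])+
    have Gq: "G = (1 - q * u / c) * qpoch_inf (q * u / c * q) q"
      using qpoch_inf_unfold[OF q(1), of "u / c * q"] by (simp add: G_def mult_ac)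
    have "askey_integrand q h c d (q / c) 0 0 u = X"
      by (simp add: askey_integrand_def X_def Th_def C_def D_def G_def mult_ac)
    moreover have "H u = (1 - d / u) * X"
    proof -
      have "H u = Th / (qpoch_inf (c / u * q) q * qpoch_inf (d / u * q) q * G) * (1 / (1 - c / u))"
        using cn uc by (simp add: H_def g_def Th_def G_def divide_simps)
      then show ?thesis
        using nzs Cq cn(1) by (simp add: X_def)
    qed
    moreover have "H (q * u) = - (d / u) * X"
    proof -
      have "H (q * u) = (c * d / (q * u ^ 2) * Th) / (C * D * qpoch_inf (q * u / c * q) q) * (q * u / (q * u - c))"
        unfolding H_def g_def qtheta_pair_dilate[OF q nz cn(1)] using q cn
        by (simp add: Th_def C_def D_def)
      also have "\<dots> = - (d / u) * (Th / (C * D * ((1 - q * u / c) * qpoch_inf (q * u / c * q) q)))"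
      proof -
        have "q * u / (q * u - c) * (c * d / (q * u ^ 2)) = - (d / u) / (1 - q * u / c)"
          using q cn uc nz by (simp add: divide_simps power2_eq_square) (simp add: algebra_simps)
        moreover have "(M * Th) / (Z * P) * K = (K * M) * (Th / (Z * P))" for M K Z P :: complex
          by simp
        moreover have "- (d / u) / L * (Th / (Z * P)) = - (d / u) * (Th / (Z * (L * P)))" for L Z P :: complex
          by (simp add: mult_ac)
        ultimately show ?thesis
          by (simp only:)
      qed
      finally show ?thesis
        unfolding X_def Gq .
    qed
    ultimately show ?thesis
      by (simp add: algebra_simps)
  qed
  have "circle_mean r (askey_integrand q h c d (q / c) 0 0) = circle_mean r (\<lambda>u. H u - H (q * u))"
    using eq by (intro circle_mean_cong r) auto
  also have "\<dots> = circle_mean r H - circle_mean (norm q * r) H"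
    using qr q r c rc by (simp add: circle_mean_diff[OF r cont contq] circle_mean_dilate cont)
  also have "\<dots> = g c"
    unfolding H_def using circle_mean_residue[OF qr(1) rc c S hol annulus] by simp
  finally have J: "circle_mean r (askey_integrand q h c d (q / c) 0 0)
      = qtheta (h * c / d) q * qtheta h q / (qpoch_inf q q * qpoch_inf (d / c * q) q * qpoch_inf q q)"
    using nz by (simp add: g_def)
  have "norm (q / c) * r < 1"
    using rc nz by (simp add: norm_divide field_simps)
  from circle_mean_askey_remove_parameter[OF this, of 0 0]
  have "qpoch_inf q q * qpoch_inf (d / c * q) q * circle_mean r (askey_integrand q h c d (q / c) 0 0)
      = circle_mean r (askey_integrand q h c d 0 0 0)"
    using nz by (simp add: mult_ac)
  moreover have "qpoch_inf q q \<noteq> 0" "qpoch_inf (d / c * q) q \<noteq> 0"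
  proof -
    have "norm (d * q) < norm c"
      using norm_mult_q_inner[OF d] rc by linarith
    then have "norm (d / c * q) < 1"
      using nz by (simp add: norm_mult norm_divide)
    then show "qpoch_inf q q \<noteq> 0" "qpoch_inf (d / c * q) q \<noteq> 0"
      using qpoch_inf_nonzero[OF q(1)] q(1) by blast+
  qed
  ultimately show ?thesis
    by (simp add: J mult.commute)
qed

end

text \<open>
  The singularities of this integrand other than \<open>0\<close> lie at \<open>c q\<^sup>k\<close> and \<open>d q\<^sup>k\<close>, so the circle may be shrunk
  until its radius exceeds \<open>\<bar>c\<bar>\<close> by so little that \<open>\<bar>q\<bar> r < \<bar>c\<bar>\<close>.
\<close>

lemma (in askey_setup) circle_mean_askey_base_le:
  assumes dc: "norm d \<le> norm c"
  shows "circle_mean r (askey_integrand q h c d 0 0 0) = qtheta h q * qtheta (h * c / d) q / qpoch_inf q q"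
proof -
  have "norm c < min r (norm c / norm q)"
    using c q nz by (simp add: field_simps)
  then obtain r' where r': "norm c < r'" "r' < r" "r' < norm c / norm q"
    using dense by (metis min_less_iff_conj)
  have "0 < r'"
    using r'(1) norm_ge_zero[of c] by linarith
  then interpret s: askey_setup q h c d r'
    using q nz r' dc by unfold_locales auto
  define S :: "complex set" where "S = {u. u \<noteq> 0 \<and> norm c < norm u \<and> norm d < norm u}"
  have S: "open S"
    unfolding S_def by (intro open_Collect_conj open_Collect_neq open_Collect_less continuous_intros)
  have hol: "askey_integrand q h c d 0 0 0 holomorphic_on S"
    unfolding askey_integrand_def
  proof (intro holomorphic_intros q)
    fix u assume u: "u \<in> S"
    then show "qpoch_inf (c / u) q * qpoch_inf (d / u) q *
           (qpoch_inf (0 * u) q * qpoch_inf (0 * u) q * qpoch_inf (0 * u) q) \<noteq> 0"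
      by (auto simp: S_def norm_divide norm_mult qpoch_inf_nonzero[OF q(1)])
  qed (use nz in \<open>auto simp: S_def\<close>)
  have "circle_mean r (askey_integrand q h c d 0 0 0) = circle_mean r' (askey_integrand q h c d 0 0 0)"
    using r' dc \<open>0 < r'\<close> by (intro circle_mean_radius_independent[OF _ _ S hol]) (auto simp: S_def)
  also have "\<dots> = qtheta h q * qtheta (h * c / d) q / qpoch_inf q q"
    using r' q by (intro s.circle_mean_askey_base_aux) (simp add: field_simps)
  finally show ?thesis .
qed

text \<open>
  The integrand is unchanged when \<open>c\<close> and \<open>d\<close> are exchanged and \<open>h\<close> becomes \<open>h c / d\<close>.
\<close>

lemma (in askey_setup) circle_mean_askey_base:
  "circle_mean r (askey_integrand q h c d 0 0 0) = qtheta h q * qtheta (h * c / d) q / qpoch_inf q q"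
proof (cases "norm d \<le> norm c")
  case False
  interpret s: askey_setup q "h * c / d" d c r
    using q nz r c d by unfold_locales auto
  have "askey_integrand q h c d 0 0 0 = askey_integrand q (h * c / d) d c 0 0 0"
    using nz by (intro ext) (simp add: askey_integrand_def mult_ac)
  then show ?thesis
    using s.circle_mean_askey_base_le False nz by (simp add: mult_ac)
qed (rule circle_mean_askey_base_le)

text \<open>
  This integral form of the nonterminating \<open>q\<close>-Saalschuetz sum follows by sending \<open>f\<^sub>1\<close>, \<open>f\<^sub>2\<close>
  and \<open>f\<^sub>3\<close> to \<open>0\<close> in turn.
\<close>

theorem (in askey_setup) circle_mean_askey:
  assumes f: "norm f1 * r < 1" "norm f2 * r < 1" "norm f3 * r < 1"
  shows "circle_mean r (askey_integrand q h c d f1 f2 f3) =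
    qtheta h q * qtheta (h * c / d) q *
      (qpoch_inf (c * d * f1 * f2) q * qpoch_inf (c * d * f1 * f3) q * qpoch_inf (c * d * f2 * f3) q) /
    (qpoch_inf q q * (qpoch_inf (c * f1) q * qpoch_inf (c * f2) q * qpoch_inf (c * f3) q) *
      (qpoch_inf (d * f1) q * qpoch_inf (d * f2) q * qpoch_inf (d * f3) q))"
proof -
  have nzf: "qpoch_inf (e * f) q \<noteq> 0" if "norm e < r" "norm f * r < 1" for e f
  proof -
    have "norm e * norm f \<le> r * norm f"
      using that by (intro mult_right_mono) auto
    then show ?thesis
      using that by (intro qpoch_inf_nonzero q) (simp add: norm_mult mult.commute)
  qed
  have step1: "qpoch_inf (c * f1) q * qpoch_inf (d * f1) q * circle_mean r (askey_integrand q h c d f1 f2 f3)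
       = qpoch_inf (c * d * f1 * f2) q * qpoch_inf (c * d * f1 * f3) q * circle_mean r (askey_integrand q h c d 0 f2 f3)"
    by (rule circle_mean_askey_remove_parameter[OF f])
  have step2: "qpoch_inf (c * f2) q * qpoch_inf (d * f2) q * circle_mean r (askey_integrand q h c d 0 f2 f3)
       = qpoch_inf (c * d * f2 * f3) q * circle_mean r (askey_integrand q h c d 0 0 f3)"
    using circle_mean_askey_remove_parameter[OF f(2), of 0 f3] f askey_integrand_swap12[of q h c d f2 0 f3]
    by simp
  have step3: "qpoch_inf (c * f3) q * qpoch_inf (d * f3) q * circle_mean r (askey_integrand q h c d 0 0 f3)
       = circle_mean r (askey_integrand q h c d 0 0 0)"
    using circle_mean_askey_remove_parameter[OF f(3), of 0 0] f askey_integrand_swap13[of q h c d f3 0 0]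
    by simp
  have nzs: "qpoch_inf (c * f1) q \<noteq> 0" "qpoch_inf (c * f2) q \<noteq> 0" "qpoch_inf (c * f3) q \<noteq> 0"
    "qpoch_inf (d * f1) q \<noteq> 0" "qpoch_inf (d * f2) q \<noteq> 0" "qpoch_inf (d * f3) q \<noteq> 0"
    using nzf c d f by auto
  define J1 J2 J3 J0 where "J1 = circle_mean r (askey_integrand q h c d f1 f2 f3)"
    and "J2 = circle_mean r (askey_integrand q h c d 0 f2 f3)"
    and "J3 = circle_mean r (askey_integrand q h c d 0 0 f3)"
    and "J0 = circle_mean r (askey_integrand q h c d 0 0 0)"
  have "J1 = qpoch_inf (c * d * f1 * f2) q * qpoch_inf (c * d * f1 * f3) q * J2 / (qpoch_inf (c * f1) q * qpoch_inf (d * f1) q)"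
    "J2 = qpoch_inf (c * d * f2 * f3) q * J3 / (qpoch_inf (c * f2) q * qpoch_inf (d * f2) q)"
    "J3 = J0 / (qpoch_inf (c * f3) q * qpoch_inf (d * f3) q)"
    using step1 step2 step3 nzs by (simp_all add: J1_def J2_def J3_def J0_def field_simps)
  then have "J1 = J0 * (qpoch_inf (c * d * f1 * f2) q * qpoch_inf (c * d * f1 * f3) q * qpoch_inf (c * d * f2 * f3) q) /
    ((qpoch_inf (c * f1) q * qpoch_inf (c * f2) q * qpoch_inf (c * f3) q) *
      (qpoch_inf (d * f1) q * qpoch_inf (d * f2) q * qpoch_inf (d * f3) q))"
    by (simp add: mult_ac)
  then show ?thesis
    unfolding J1_def J0_def circle_mean_askey_base by (simp add: mult_ac)
qed

section \<open>Expansion of the integrand\<close>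

lemma circle_mean_sums:
  assumes r: "r > 0" and cont: "\<And>j. continuous_on (sphere 0 r) (F j)"
    and M: "summable M" "\<And>j u. norm u = r \<Longrightarrow> norm (F j u) \<le> M j"
  shows "(\<lambda>j. circle_mean r (F j)) sums circle_mean r (\<lambda>u. \<Sum>j. F j u)"
proof -
  let ?f = "\<lambda>n \<psi>. \<Sum>j<n. F j (of_real r * cis \<psi>)"
  let ?g = "\<lambda>\<psi>. \<Sum>j. F j (of_real r * cis \<psi>)"
  have "uniform_limit {- pi..pi} ?f ?g sequentially"
    using r by (intro Weierstrass_m_test[OF _ M(1)] M(2)) (auto simp: norm_mult)
  moreover have "continuous_on {- pi..pi} (?f n)" for n
    by (intro continuous_on_sum continuous_on_circle[OF r cont])
  ultimately obtain I J where IJ: "\<And>n. (?f n has_integral I n) {- pi..pi}"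
      "(?g has_integral J) {- pi..pi}" "I \<longlonglongrightarrow> J"
    using uniform_limit_integral[where a="- pi" and b=pi and f="?f" and g="?g" and F=sequentially] by auto
  have "I = (\<lambda>n. \<Sum>j<n. integral {- pi..pi} (\<lambda>\<psi>. F j (of_real r * cis \<psi>)))"
  proof
    fix n show "I n = (\<Sum>j<n. integral {- pi..pi} (\<lambda>\<psi>. F j (of_real r * cis \<psi>)))"
      using integral_unique[OF IJ(1), of n]
        integral_sum[of "{..<n}" "\<lambda>j \<psi>. F j (of_real r * cis \<psi>)" "{- pi..pi}"]
        integrable_on_circle[OF r cont] by simp
  qed
  then have "(\<lambda>j. integral {- pi..pi} (\<lambda>\<psi>. F j (of_real r * cis \<psi>))) sums integral {- pi..pi} ?g"
    using IJ(3) integral_unique[OF IJ(2)] by (simp add: sums_def)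
  then show ?thesis
    unfolding circle_mean_def by (rule sums_divide)
qed

text \<open>
  Here \<open>A = a\<^sup>-\<^sup>1 (x y z / q)\<^sup>1\<^sup>/\<^sup>2\<close>, and \<open>u = w / \<sigma>\<close> runs over the circle of radius \<open>r = 1/\<sigma>\<close>. The
  inner parameters are \<open>A\<close> and \<open>1/A\<close>, the outer ones \<open>x/A\<close>, \<open>y/A\<close> and \<open>z/A\<close>. The parameters that occur
  with both signs enter through their squares, so that \<open>A\<close> is the only square root left.
\<close>

locale quadratic_setup =
  fixes q a b x y z h A :: complex and r :: real
  assumes q: "norm q < 1" "q \<noteq> 0"
    and nz: "a \<noteq> 0" "b \<noteq> 0" "x \<noteq> 0" "y \<noteq> 0" "z \<noteq> 0" "h \<noteq> 0" "A \<noteq> 0"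
    and A: "q * a ^ 2 * A ^ 2 = x * y * z"
    and r: "r > 0" and Ar: "norm A < r" "norm (1 / A) < r"
    and fr: "norm (x / A) * r < 1" "norm (y / A) * r < 1" "norm (z / A) * r < 1"
    and br: "norm (q * a ^ 2 / (b ^ 2 * A ^ 2)) * r ^ 2 < 1"
    and denom: "qpoch_inf (q * a ^ 2 / x) q \<noteq> 0" "qpoch_inf (q * a ^ 2 / y) q \<noteq> 0"
      "qpoch_inf (q * a ^ 2 / z) q \<noteq> 0" "qpoch_inf (q ^ 2 * a ^ 2 / b ^ 2) (q ^ 2) \<noteq> 0"
begin

lemma q2: "norm (q ^ 2) < 1"
  using q by (simp add: norm_power power_less_one_iff)

lemma Aq: "norm (A * q ^ m) < r"
  using norm_mult_power_le[OF q(1), of A m] Ar by linarith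

sublocale askey: askey_setup q h "A * q ^ m" "1 / A" r for m
  using q nz r Aq Ar by unfold_locales auto

text \<open>
  The factors of the integrand that do not take part in the series expansion.
\<close>

definition weight :: "complex \<Rightarrow> complex" where
  "weight u = qtheta (h * A * u) q * qtheta (h * A / u) q /
     (qpoch_inf (A / u) q * qpoch_inf (1 / A / u) q *
      (qpoch_inf (x / A * u) q * qpoch_inf (y / A * u) q * qpoch_inf (z / A * u) q))"

definition vwp_term :: "nat \<Rightarrow> complex" where
  "vwp_term j = (1 - a ^ 2 * (q ^ 2) ^ (2 * j)) *
     (qpoch (a ^ 2) (q ^ 2) j * qpoch (b ^ 2) (q ^ 2) j /
       (qpoch (q ^ 2) (q ^ 2) j * qpoch (q ^ 2 * a ^ 2 / b ^ 2) (q ^ 2) j)) *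
     (qpoch x q (2 * j) * qpoch y q (2 * j) * qpoch z q (2 * j) /
       (qpoch (q * a ^ 2 / x) q (2 * j) * qpoch (q * a ^ 2 / y) q (2 * j) * qpoch (q * a ^ 2 / z) q (2 * j))) *
     (q * a ^ 2 / (b ^ 2 * A ^ 4)) ^ j"

text \<open>
  The part of a series term that does not depend on the point \<open>u\<close> of the circle.
\<close>

definition expansion_coeff :: "nat \<Rightarrow> complex" where
  "expansion_coeff j = (1 - a ^ 2 * (q ^ 2) ^ (2 * j)) * (qpoch (a ^ 2) (q ^ 2) j / qpoch (q ^ 2) (q ^ 2) j) *
     (qpoch (b ^ 2) (q ^ 2) j * qpoch_inf (q ^ 2 * a ^ 2 / b ^ 2 * (q ^ 2) ^ j) (q ^ 2)) *
     (q * a ^ 2 / (b ^ 2 * A ^ 2)) ^ j"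

text \<open>
  The parameters \<open>A/u\<close> and \<open>q A/u\<close> in base \<open>q\<^sup>2\<close> combine to \<open>(A/u; q)\<^sub>2\<^sub>j\<close>, and likewise for the
  denominators. This is where the quadratic nature of the formula comes from.
\<close>

lemma phi65_term_circle:
  assumes u: "u \<noteq> 0"
  shows "phi65_term (a ^ 2) (q ^ 2) (1 / b ^ 2) (u / A) (u / (q * A)) j
    = expansion_coeff j * u ^ (2 * j) * qpoch (A / u) q (2 * j) * qpoch_inf (q * a ^ 2 / A * q ^ (2 * j) * u) q"
proof -
  have 1: "phi65_factor (a ^ 2) (q ^ 2) j (1 / b ^ 2)
      = (1 / b ^ 2) ^ j * (qpoch (b ^ 2) (q ^ 2) j * qpoch_inf (q ^ 2 * a ^ 2 / b ^ 2 * (q ^ 2) ^ j) (q ^ 2))"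
    using nz by (simp add: phi65_factor_def inv_qpoch_eq mult_ac)
  have X: "qpoch_inf (q * a ^ 2 / A * q ^ (2 * j) * u) q
      = qpoch_inf (a ^ 2 * (u / (q * A)) * (q ^ 2) ^ Suc j) (q ^ 2) * qpoch_inf (a ^ 2 * (u / A) * (q ^ 2) ^ Suc j) (q ^ 2)"
  proof -
    have "q * a ^ 2 / A * q ^ (2 * j) * u = a ^ 2 * (u / (q * A)) * (q ^ 2) ^ Suc j"
      "q * a ^ 2 / A * q ^ (2 * j) * u * q = a ^ 2 * (u / A) * (q ^ 2) ^ Suc j"
      using q nz by (simp_all add: power_mult power2_eq_square)
    then show ?thesis
      using qpoch_inf_even_odd[OF q(1), of "q * a ^ 2 / A * q ^ (2 * j) * u"] by simp
  qed
  have 2: "phi65_factor (a ^ 2) (q ^ 2) j (u / A) * phi65_factor (a ^ 2) (q ^ 2) j (u / (q * A))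
      = (u / A * (u / (q * A))) ^ j * qpoch (A / u) q (2 * j) * qpoch_inf (q * a ^ 2 / A * q ^ (2 * j) * u) q"
    unfolding X qpoch_double phi65_factor_def power_mult_distrib
    using nz q u by (simp add: inv_qpoch_eq mult_ac)
  have 3: "(1 / b ^ 2) ^ j * (u / A * (u / (q * A))) ^ j * (a ^ 2 * q ^ 2) ^ j = (q * a ^ 2 / (b ^ 2 * A ^ 2)) ^ j * u ^ (2 * j)"
    unfolding power_mult[of u] power_mult_distrib[symmetric]
    using q nz by (simp add: power2_eq_square mult_ac)
  have "phi65_factor (a ^ 2) (q ^ 2) j (1 / b ^ 2) * phi65_factor (a ^ 2) (q ^ 2) j (u / A) * phi65_factor (a ^ 2) (q ^ 2) j (u / (q * A))
     = (1 / b ^ 2) ^ j * (qpoch (b ^ 2) (q ^ 2) j * qpoch_inf (q ^ 2 * a ^ 2 / b ^ 2 * (q ^ 2) ^ j) (q ^ 2)) *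
       ((u / A * (u / (q * A))) ^ j * qpoch (A / u) q (2 * j) * qpoch_inf (q * a ^ 2 / A * q ^ (2 * j) * u) q)"
    unfolding 1[symmetric] 2[symmetric] by (rule mult.assoc)
  then have "phi65_term (a ^ 2) (q ^ 2) (1 / b ^ 2) (u / A) (u / (q * A)) j
     = (1 - a ^ 2 * (q ^ 2) ^ (2 * j)) * (qpoch (a ^ 2) (q ^ 2) j / qpoch (q ^ 2) (q ^ 2) j) *
     (qpoch (b ^ 2) (q ^ 2) j * qpoch_inf (q ^ 2 * a ^ 2 / b ^ 2 * (q ^ 2) ^ j) (q ^ 2)) *
     ((1 / b ^ 2) ^ j * (u / A * (u / (q * A))) ^ j * (a ^ 2 * q ^ 2) ^ j) *
     qpoch (A / u) q (2 * j) * qpoch_inf (q * a ^ 2 / A * q ^ (2 * j) * u) q"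
    unfolding phi65_term_def by (simp only: mult_ac)
  then show ?thesis
    unfolding 3 expansion_coeff_def by (simp only: mult_ac)
qed

text \<open>
  The factor \<open>(A/u; q)\<^sub>2\<^sub>j\<close> turns the inner parameter \<open>A\<close> into \<open>A q\<^sup>2\<^sup>j\<close>, and \<open>u\<^sup>2\<^sup>j\<close> is precisely what
  the theta function needs for the same change.
\<close>

lemma weight_phi65_term:
  assumes u: "norm u = r"
  shows "weight u * phi65_term (a ^ 2) (q ^ 2) (1 / b ^ 2) (u / A) (u / (q * A)) j
    = expansion_coeff j * ((- (h * A)) ^ (2 * j) * (\<Prod>i<2 * j. q ^ i)) *
      askey_integrand q h (A * q ^ (2 * j)) (1 / A) (x / A) (y / A) (z / A) u"
proof -
  have u0: "u \<noteq> 0"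
    using u r by auto
  define m where "m = 2 * j"
  have th: "qtheta (h * A / u) q = (- (h * A)) ^ m / u ^ m * (\<Prod>i<m. q ^ i) * qtheta (h * (A * q ^ m) / u) q"
    using qtheta_mult_q_power[OF q, of "h * A / u" m] nz u0
    by (simp add: mult_ac power_divide[symmetric])
  have sp: "qpoch_inf (A / u) q = qpoch (A / u) q m * qpoch_inf (A * q ^ m / u) q"
    using qpoch_inf_split[OF q(1), of "A / u" m] by simp
  have "qpoch_inf (A / u) q \<noteq> 0"
    using askey.circle_nonzero(2)[OF u, of 0] by simp
  then have qp: "qpoch (A / u) q m \<noteq> 0"
    by (simp add: sp)
  have F: "A * q ^ m * (1 / A) * (x / A) * (y / A) * (z / A) * u = q * a ^ 2 / A * q ^ m * u"
  proof -
    have "x / A * (y / A) * (z / A) = q * a ^ 2 / A"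
      using nz A[symmetric] by (simp add: field_simps power2_eq_square)
    moreover have "A * q ^ m * (1 / A) * (x / A) * (y / A) * (z / A) * u = A * (1 / A) * (x / A * (y / A) * (z / A)) * q ^ m * u"
      by (simp only: mult_ac)
    ultimately show ?thesis
      using nz by simp
  qed
  show ?thesis
    unfolding weight_def phi65_term_circle[OF u0] askey_integrand_def m_def[symmetric] th sp F
    using u0 qp by (simp add: mult_ac)
qed

text \<open>
  The common factor of the means of all terms. Apart from \<open>2 \<pi>\<close> and \<open>(q a, - q a; q)\<^sub>\<infinity>\<close> it is the
  reciprocal of the factor in front of the integral in the theorem.
\<close>

definition mean_const :: complex where
  "mean_const = qpoch_inf (q ^ 2 * a ^ 2 / b ^ 2) (q ^ 2) * (qtheta h q * qtheta (h * A ^ 2) q) *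
     (qpoch_inf (q * a ^ 2 / x) q * qpoch_inf (q * a ^ 2 / y) q * qpoch_inf (q * a ^ 2 / z) q) /
     (qpoch_inf q q * (qpoch_inf x q * qpoch_inf y q * qpoch_inf z q) *
      (qpoch_inf (q * a ^ 2 / (y * z)) q * qpoch_inf (q * a ^ 2 / (x * z)) q * qpoch_inf (q * a ^ 2 / (x * y)) q))"

lemma xyz_nonzero: "qpoch_inf x q \<noteq> 0" "qpoch_inf y q \<noteq> 0" "qpoch_inf z q \<noteq> 0"
proof -
  have "qpoch_inf t q \<noteq> 0" if "norm (t / A) * r < 1" for t
  proof -
    have "norm (t / A) * norm A \<le> norm (t / A) * r"
      using Ar by (intro mult_left_mono) auto
    moreover have "norm (t / A) * norm A = norm t"
      using nz by (simp add: norm_divide)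
    ultimately show ?thesis
      using that by (intro qpoch_inf_nonzero q) linarith
  qed
  then show "qpoch_inf x q \<noteq> 0" "qpoch_inf y q \<noteq> 0" "qpoch_inf z q \<noteq> 0"
    using fr by auto
qed

lemma mean_const_nonzero:
  assumes "qtheta h q \<noteq> 0" "qtheta (h * A ^ 2) q \<noteq> 0"
  shows "mean_const \<noteq> 0"
proof -
  have "qpoch_inf (1 / A * f) q \<noteq> 0" if "norm f * r < 1" for f
  proof -
    have "norm f * norm (1 / A) \<le> norm f * r"
      using Ar by (intro mult_left_mono) auto
    moreover have "norm (1 / A * f) = norm f * norm (1 / A)"
      by (simp add: norm_mult norm_divide)
    ultimately show ?thesis
      using that by (intro qpoch_inf_nonzero q) linarith
  qed
  moreover have "1 / A * (x / A) = q * a ^ 2 / (y * z)" "1 / A * (y / A) = q * a ^ 2 / (x * z)"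
    "1 / A * (z / A) = q * a ^ 2 / (x * y)"
    using nz A by (simp_all add: field_simps power2_eq_square)
  ultimately have "qpoch_inf (q * a ^ 2 / (y * z)) q \<noteq> 0" "qpoch_inf (q * a ^ 2 / (x * z)) q \<noteq> 0"
    "qpoch_inf (q * a ^ 2 / (x * y)) q \<noteq> 0"
    using fr by metis+
  then show ?thesis
    using assms xyz_nonzero denom qpoch_inf_nonzero[OF q(1) q(1)] by (simp add: mean_const_def)
qed

lemma circle_mean_weight_term:
  "circle_mean r (\<lambda>u. weight u * phi65_term (a ^ 2) (q ^ 2) (1 / b ^ 2) (u / A) (u / (q * A)) j)
    = mean_const * vwp_term j"
proof -
  define m where "m = 2 * j"
  define R where "R = (- (h * A)) ^ m * (\<Prod>i<m. q ^ i)"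
  define X where "X = qpoch_inf (q * a ^ 2 / x * q ^ m) q"
  define Y where "Y = qpoch_inf (q * a ^ 2 / y * q ^ m) q"
  define Z where "Z = qpoch_inf (q * a ^ 2 / z * q ^ m) q"
  define U where "U = qpoch_inf (q * a ^ 2 / (y * z)) q * qpoch_inf (q * a ^ 2 / (x * z)) q * qpoch_inf (q * a ^ 2 / (x * y)) q"
  have "circle_mean r (\<lambda>u. weight u * phi65_term (a ^ 2) (q ^ 2) (1 / b ^ 2) (u / A) (u / (q * A)) j)
    = circle_mean r (\<lambda>u. expansion_coeff j * R * askey_integrand q h (A * q ^ m) (1 / A) (x / A) (y / A) (z / A) u)"
    unfolding R_def m_def by (intro circle_mean_cong r weight_phi65_term)
  also have "\<dots> = expansion_coeff j * R * circle_mean r (askey_integrand q h (A * q ^ m) (1 / A) (x / A) (y / A) (z / A))"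
    by (rule circle_mean_cmult)
  also have "circle_mean r (askey_integrand q h (A * q ^ m) (1 / A) (x / A) (y / A) (z / A)) =
     qtheta h q * qtheta (h * A ^ 2 * q ^ m) q * (Z * Y * X) /
     (qpoch_inf q q * (qpoch_inf (x * q ^ m) q * qpoch_inf (y * q ^ m) q * qpoch_inf (z * q ^ m) q) * U)"
  proof -
    have e: "h * (A * q ^ m) / (1 / A) = h * A ^ 2 * q ^ m"
      "A * q ^ m * (x / A) = x * q ^ m" "A * q ^ m * (y / A) = y * q ^ m" "A * q ^ m * (z / A) = z * q ^ m"
      using nz by (simp_all add: power2_eq_square)
    have e2: "1 / A * (x / A) = q * a ^ 2 / (y * z)" "1 / A * (y / A) = q * a ^ 2 / (x * z)"
      "1 / A * (z / A) = q * a ^ 2 / (x * y)"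
      using nz A by (simp_all add: field_simps power2_eq_square)
    have e3: "A * q ^ m * (1 / A) * (x / A) * (y / A) = q * a ^ 2 / z * q ^ m"
      "A * q ^ m * (1 / A) * (x / A) * (z / A) = q * a ^ 2 / y * q ^ m"
      "A * q ^ m * (1 / A) * (y / A) * (z / A) = q * a ^ 2 / x * q ^ m"
      using nz A by (simp_all add: field_simps power2_eq_square)
    show ?thesis
      unfolding askey.circle_mean_askey[OF fr] e e2 e3 X_def Y_def Z_def U_def ..
  qed
  also have "expansion_coeff j * R * (qtheta h q * qtheta (h * A ^ 2 * q ^ m) q * (Z * Y * X) /
     (qpoch_inf q q * (qpoch_inf (x * q ^ m) q * qpoch_inf (y * q ^ m) q * qpoch_inf (z * q ^ m) q) * U))
    = mean_const * vwp_term j"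
  proof -
    have th: "R * qtheta (h * A ^ 2 * q ^ m) q = qtheta (h * A ^ 2) q / A ^ m"
    proof -
      have "qtheta (h * A ^ 2) q = (- (h * A) * A) ^ m * (\<Prod>i<m. q ^ i) * qtheta (h * A ^ 2 * q ^ m) q"
        using qtheta_mult_q_power[OF q, of "h * A ^ 2" m] nz by (simp add: power2_eq_square mult_ac)
      then show ?thesis
        unfolding power_mult_distrib[of "- (h * A)" A] R_def using nz by simp
    qed
    define Vx Vy Vz where "Vx = qpoch x q m" and "Vy = qpoch y q m" and "Vz = qpoch z q m"
    define Wx Wy Wz where "Wx = qpoch (q * a ^ 2 / x) q m" and "Wy = qpoch (q * a ^ 2 / y) q m" and "Wz = qpoch (q * a ^ 2 / z) q m"
    have s1: "qpoch_inf x q = Vx * qpoch_inf (x * q ^ m) q" "qpoch_inf y q = Vy * qpoch_inf (y * q ^ m) q"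
      "qpoch_inf z q = Vz * qpoch_inf (z * q ^ m) q"
      unfolding Vx_def Vy_def Vz_def by (rule qpoch_inf_split[OF q(1)])+
    have s2: "qpoch_inf (q * a ^ 2 / x) q = Wx * X" "qpoch_inf (q * a ^ 2 / y) q = Wy * Y" "qpoch_inf (q * a ^ 2 / z) q = Wz * Z"
      unfolding Wx_def Wy_def Wz_def X_def Y_def Z_def by (rule qpoch_inf_split[OF q(1)])+
    define B where "B = qpoch_inf (q ^ 2 * a ^ 2 / b ^ 2 * (q ^ 2) ^ j) (q ^ 2)"
    define Wb where "Wb = qpoch (q ^ 2 * a ^ 2 / b ^ 2) (q ^ 2) j"
    have s3: "qpoch_inf (q ^ 2 * a ^ 2 / b ^ 2) (q ^ 2) = Wb * B"
      unfolding Wb_def B_def by (rule qpoch_inf_split[OF q2])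
    have nzs: "Vx \<noteq> 0" "Vy \<noteq> 0" "Vz \<noteq> 0" "Wx \<noteq> 0" "Wy \<noteq> 0" "Wz \<noteq> 0" "Wb \<noteq> 0"
      using xyz_nonzero denom by (auto simp: s1 s2 s3)
    have pw: "(q * a ^ 2 / (b ^ 2 * A ^ 2)) ^ j / A ^ m = (q * a ^ 2 / (b ^ 2 * A ^ 4)) ^ j"
      unfolding m_def power_mult[of A] power_divide[symmetric] by (simp add: power_numeral_reduce mult_ac)
    define E where "E = (1 - a ^ 2 * (q ^ 2) ^ (2 * j)) * (qpoch (a ^ 2) (q ^ 2) j / qpoch (q ^ 2) (q ^ 2) j) * qpoch (b ^ 2) (q ^ 2) j"
    have "expansion_coeff j = E * B * (q * a ^ 2 / (b ^ 2 * A ^ 2)) ^ j"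
      by (simp add: expansion_coeff_def E_def B_def)
    then have "expansion_coeff j * R * (qtheta h q * qtheta (h * A ^ 2 * q ^ m) q * (Z * Y * X) /
       (qpoch_inf q q * (qpoch_inf (x * q ^ m) q * qpoch_inf (y * q ^ m) q * qpoch_inf (z * q ^ m) q) * U))
      = E * B * (q * a ^ 2 / (b ^ 2 * A ^ 2)) ^ j * (R * qtheta (h * A ^ 2 * q ^ m) q) * (qtheta h q * (Z * Y * X) /
       (qpoch_inf q q * (qpoch_inf (x * q ^ m) q * qpoch_inf (y * q ^ m) q * qpoch_inf (z * q ^ m) q) * U))"
      by simp
    also have "\<dots> = E * B * ((q * a ^ 2 / (b ^ 2 * A ^ 2)) ^ j / A ^ m) * qtheta (h * A ^ 2) q * (qtheta h q * (Z * Y * X) /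
       (qpoch_inf q q * (qpoch_inf (x * q ^ m) q * qpoch_inf (y * q ^ m) q * qpoch_inf (z * q ^ m) q) * U))"
      unfolding th by simp
    also have "\<dots> = mean_const * (E / Wb * (Vx * Vy * Vz / (Wx * Wy * Wz)) * (q * a ^ 2 / (b ^ 2 * A ^ 4)) ^ j)"
      unfolding pw mean_const_def U_def[symmetric] s1 s2 s3 using nzs by (simp add: mult_ac)
    also have "E / Wb * (Vx * Vy * Vz / (Wx * Wy * Wz)) * (q * a ^ 2 / (b ^ 2 * A ^ 4)) ^ j = vwp_term j"
      by (simp add: vwp_term_def E_def Wb_def Vx_def Vy_def Vz_def Wx_def Wy_def Wz_def m_def)
    finally show ?thesis .
  qed
  finally show ?thesis .
qed

lemma continuous_on_weight: "continuous_on (sphere 0 r) weight"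
proof -
  have den: "qpoch_inf (A / u) q * qpoch_inf (1 / A / u) q *
      (qpoch_inf (x / A * u) q * qpoch_inf (y / A * u) q * qpoch_inf (z / A * u) q) \<noteq> 0"
    if "u \<in> sphere 0 r" for u
  proof -
    have u: "norm u = r"
      using that by simp
    show ?thesis
      using askey.circle_nonzero(2)[OF u, of 0] askey.circle_nonzero(3)[OF u] askey.circle_nonzero(4)[OF u fr(1)]
        askey.circle_nonzero(4)[OF u fr(2)] askey.circle_nonzero(4)[OF u fr(3)] by simp
  qed
  show ?thesis
    unfolding weight_def by (intro continuous_intros q) (use den nz r in auto)
qed

lemma vwp_term_sums:
  "(\<lambda>j. mean_const * vwp_term j) sums
     circle_mean r (\<lambda>u. weight u * phi65 (a ^ 2) (q ^ 2) (1 / b ^ 2) (u / A) (u / (q * A)))"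
proof -
  let ?T = "\<lambda>j u. phi65_term (a ^ 2) (q ^ 2) (1 / b ^ 2) (u / A) (u / (q * A)) j"
  have "compact (weight ` sphere 0 r)"
    using continuous_on_weight by (intro compact_continuous_image) auto
  then obtain B where "\<forall>s\<in>weight ` sphere 0 r. norm s \<le> B"
    using compact_imp_bounded bounded_iff by metis
  then have B: "norm (weight u) \<le> B" if "norm u = r" for u :: complex
    using that by simp
  have \<rho>: "norm (1 / b ^ 2) > 0" "norm (r / A) > 0" "norm (r / (q * A)) > 0"
    using nz q r by auto
  have "norm (a ^ 2 * q ^ 2) * (norm (1 / b ^ 2) * norm (r / A) * norm (r / (q * A))) < 1"
    using br r q nz by (simp add: norm_mult norm_divide norm_power power2_eq_square field_simps)
  from phi65_term_bound[OF q2 \<rho> this] obtain M where M: "summable M"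
    "\<forall>k \<beta> \<gamma> \<delta>. norm \<beta> \<le> norm (1 / b ^ 2) \<longrightarrow> norm \<gamma> \<le> norm (r / A) \<longrightarrow> norm \<delta> \<le> norm (r / (q * A)) \<longrightarrow>
       norm (phi65_term (a ^ 2) (q ^ 2) \<beta> \<gamma> \<delta> k) \<le> M k"
    by metis
  have T: "norm (?T j u) \<le> M j" if "norm u = r" for j and u :: complex
    using M(2) that r by (simp add: norm_divide norm_mult)
  have "(\<lambda>j. circle_mean r (\<lambda>u. weight u * ?T j u)) sums circle_mean r (\<lambda>u. \<Sum>j. weight u * ?T j u)"
  proof (rule circle_mean_sums[OF r])
    show "continuous_on (sphere 0 r) (\<lambda>u. weight u * ?T j u)" for j
      unfolding phi65_term_def phi65_factor_def inv_qpoch_def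
      using nz q by (intro continuous_intros continuous_on_weight q2) auto
    show "summable (\<lambda>j. B * M j)"
      using M(1) by (rule summable_mult)
    show "norm (weight u * ?T j u) \<le> B * M j" if "norm u = r" for j and u :: complex
      unfolding norm_mult using B[OF that] T[OF that] by (intro mult_mono) (auto intro: order_trans[OF norm_ge_zero])
  qed
  moreover have "circle_mean r (\<lambda>u. \<Sum>j. weight u * ?T j u)
      = circle_mean r (\<lambda>u. weight u * phi65 (a ^ 2) (q ^ 2) (1 / b ^ 2) (u / A) (u / (q * A)))"
  proof (rule circle_mean_cong[OF r])
    fix u :: complex assume u: "norm u = r"
    have "summable (\<lambda>j. ?T j u)"
      by (rule summable_comparison_test'[OF M(1) T[OF u]])
    then show "(\<Sum>j. weight u * ?T j u) = weight u * phi65 (a ^ 2) (q ^ 2) (1 / b ^ 2) (u / A) (u / (q * A))"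
      by (simp add: phi65_def suminf_mult)
  qed
  ultimately show ?thesis
    by (simp add: circle_mean_weight_term)
qed

text \<open>
  In base \<open>q\<^sup>2\<close> the product side of the sum consists of pairs \<open>(t, t q; q\<^sup>2)\<^sub>\<infinity> = (t; q)\<^sub>\<infinity>\<close> and of squares
  \<open>(t\<^sup>2; q\<^sup>2)\<^sub>\<infinity> = (t, - t; q)\<^sub>\<infinity>\<close>, which are the remaining factors of the integrand.
\<close>

lemma weight_phi65:
  assumes u: "norm u = r" and s: "s ^ 2 = q * a ^ 2 / (b ^ 2 * A ^ 2)" and e: "e ^ 2 = q * a ^ 2 / A ^ 2"
  shows "weight u * phi65 (a ^ 2) (q ^ 2) (1 / b ^ 2) (u / A) (u / (q * A))
    = qpoch_inf (a ^ 2) (q ^ 2) *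
      (qtheta (h * A * u) q * qtheta (h * A / u) q * (qpoch_inf (e * u) q * qpoch_inf (- (e * u)) q * qpoch_inf (q * a ^ 2 / (b ^ 2 * A) * u) q) /
       (qpoch_inf (A / u) q * qpoch_inf (1 / A / u) q *
        (qpoch_inf (x / A * u) q * qpoch_inf (y / A * u) q * qpoch_inf (z / A * u) q * qpoch_inf (s * u) q * qpoch_inf (- (s * u)) q)))"
proof -
  have e1: "a ^ 2 * q ^ 2 * (1 / b ^ 2) * (u / A) * (u / (q * A)) = (s * u) ^ 2"
    "a ^ 2 * q ^ 2 * (u / A) * (u / (q * A)) = (e * u) ^ 2"
    unfolding power_mult_distrib s e using nz q by (simp_all add: power2_eq_square mult_ac)
  have e2: "a ^ 2 * q ^ 2 * (1 / b ^ 2) * (u / (q * A)) = q * a ^ 2 / (b ^ 2 * A) * u"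
    "a ^ 2 * q ^ 2 * (1 / b ^ 2) * (u / A) = q * a ^ 2 / (b ^ 2 * A) * u * q"
    using nz q by (simp_all add: power2_eq_square mult_ac)
  have "norm ((s * u) ^ 2) < 1"
    using br u by (simp add: power_mult_distrib s norm_mult norm_power norm_divide)
  then have conv: "norm (a ^ 2 * q ^ 2 * (1 / b ^ 2 * (u / A) * (u / (q * A)))) < 1"
    using e1(1) by (simp add: mult_ac)
  have su: "norm (s * u) < 1"
    using \<open>norm ((s * u) ^ 2) < 1\<close> by (simp add: norm_power power_less_one_iff)
  then have nzs: "qpoch_inf (s * u) q \<noteq> 0" "qpoch_inf (- (s * u)) q \<noteq> 0"
    by (auto intro!: qpoch_inf_nonzero[OF q(1)])
  have sum: "qpoch_inf t0 (q ^ 2) * phi65 (a ^ 2) (q ^ 2) (1 / b ^ 2) (u / A) (u / (q * A))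
      = qpoch_inf (a ^ 2) (q ^ 2) * qpoch_inf t1 (q ^ 2) * qpoch_inf t2 (q ^ 2) * qpoch_inf t3 (q ^ 2)"
    if "t0 = a ^ 2 * q ^ 2 * (1 / b ^ 2) * (u / A) * (u / (q * A))" "t1 = a ^ 2 * q ^ 2 * (1 / b ^ 2) * (u / A)"
      "t2 = a ^ 2 * q ^ 2 * (1 / b ^ 2) * (u / (q * A))" "t3 = a ^ 2 * q ^ 2 * (u / A) * (u / (q * A))" for t0 t1 t2 t3
    unfolding that by (rule phi65_sum[OF q2 conv])
  have "qpoch_inf (s * u) q * qpoch_inf (- (s * u)) q * phi65 (a ^ 2) (q ^ 2) (1 / b ^ 2) (u / A) (u / (q * A))
     = qpoch_inf (a ^ 2) (q ^ 2) * qpoch_inf (q * a ^ 2 / (b ^ 2 * A) * u) q * (qpoch_inf (e * u) q * qpoch_inf (- (e * u)) q)"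
    using sum[OF e1(1)[symmetric] e2(2)[symmetric] e2(1)[symmetric] e1(2)[symmetric]]
    unfolding qpoch_inf_even_odd[OF q(1), of "q * a ^ 2 / (b ^ 2 * A) * u"] qpoch_inf_square[OF q(1), of "s * u"]
      qpoch_inf_square[OF q(1), of "e * u"] by (simp only: mult_ac)
  then have S: "phi65 (a ^ 2) (q ^ 2) (1 / b ^ 2) (u / A) (u / (q * A))
     = qpoch_inf (a ^ 2) (q ^ 2) * qpoch_inf (q * a ^ 2 / (b ^ 2 * A) * u) q * (qpoch_inf (e * u) q * qpoch_inf (- (e * u)) q) /
       (qpoch_inf (s * u) q * qpoch_inf (- (s * u)) q)"
    using nzs by (simp add: field_simps)
  show ?thesis
    unfolding S weight_def by (simp add: mult_ac)
qed

end

section \<open>The integral representation of the very-well-poised series\<close>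

text \<open>
  Each pair \<open>x, q x\<close> in base \<open>q\<^sup>2\<close> gives a factorial of length \<open>2 j\<close> in base \<open>q\<close>, and the square
  roots of \<open>\<alpha> = a\<^sup>2\<close> combine to the very-well-poised factor. Their non-vanishing in the denominator
  rules out \<open>a\<^sup>2 = 1\<close>.
\<close>

lemma very_well_poised_quadratic:
  assumes nz: "q \<noteq> 0" "x \<noteq> 0" "y \<noteq> 0" "z \<noteq> 0"
    and "nonvanishing_denominators (vwp_lower (a ^ 2) [b ^ 2, x, q * x, y, q * y, z, q * z] (q ^ 2)) (q ^ 2)"
  shows "very_well_poised (a ^ 2) [b ^ 2, x, q * x, y, q * y, z, q * z] (q ^ 2) t
    = (\<Sum>j. (1 - a ^ 2 * (q ^ 2) ^ (2 * j)) *
     (qpoch (a ^ 2) (q ^ 2) j * qpoch (b ^ 2) (q ^ 2) j /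
       (qpoch (q ^ 2) (q ^ 2) j * qpoch (q ^ 2 * a ^ 2 / b ^ 2) (q ^ 2) j)) *
     (qpoch x q (2 * j) * qpoch y q (2 * j) * qpoch z q (2 * j) /
       (qpoch (q * a ^ 2 / x) q (2 * j) * qpoch (q * a ^ 2 / y) q (2 * j) * qpoch (q * a ^ 2 / z) q (2 * j))) *
     t ^ j / (1 - a ^ 2))"
    and "a ^ 2 \<noteq> 1"
proof -
  define s where "s = csqrt (a ^ 2)"
  have s2: "s ^ 2 = a ^ 2"
    by (simp add: s_def)
  have s_nz: "qpoch s (q ^ 2) k \<noteq> 0" "qpoch (- s) (q ^ 2) k \<noteq> 0" for k
    using assms(5) by (auto simp: nonvanishing_denominators_def vwp_lower_def qpochs_def s_def)
  have s1: "1 - s \<noteq> 0" "1 + s \<noteq> 0"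
    using s_nz[of 1] by (auto simp: qpoch_def)
  have a1: "1 - a ^ 2 = (1 - s) * (1 + s)"
    unfolding s2[symmetric] by (simp add: power2_eq_square algebra_simps)
  then show a2: "a ^ 2 \<noteq> 1"
    using s1 by auto
  have sh: "qpoch (q ^ 2 * e) (q ^ 2) j = qpoch e (q ^ 2) j * (1 - e * (q ^ 2) ^ j) / (1 - e)" if "1 - e \<noteq> 0" for e j
    using that qpoch_Suc[of e "q ^ 2" j] qpoch_Suc_shift[of e "q ^ 2" j] by (simp add: field_simps)
  have pair: "qpoch (q ^ 2 * s) (q ^ 2) j * qpoch (- (q ^ 2 * s)) (q ^ 2) j / (qpoch s (q ^ 2) j * qpoch (- s) (q ^ 2) j)
      = (1 - a ^ 2 * (q ^ 2) ^ (2 * j)) / (1 - a ^ 2)" for j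
  proof -
    have "qpoch (q ^ 2 * s) (q ^ 2) j * qpoch (q ^ 2 * (- s)) (q ^ 2) j / (qpoch s (q ^ 2) j * qpoch (- s) (q ^ 2) j)
      = (1 - s * (q ^ 2) ^ j) * (1 + s * (q ^ 2) ^ j) / ((1 - s) * (1 + s))"
      using sh[of s j] sh[of "- s" j] s1 s_nz[of j] by simp
    also have "(1 - s * (q ^ 2) ^ j) * (1 + s * (q ^ 2) ^ j) = 1 - a ^ 2 * (q ^ 2) ^ (2 * j)"
      unfolding s2[symmetric] by (simp add: power_mult power2_eq_square power_mult_distrib algebra_simps)
    finally show ?thesis
      by (simp add: a1)
  qed
  have dbl: "qpoch x (q ^ 2) j * qpoch (q * x) (q ^ 2) j = qpoch x q (2 * j)" for x j
    by (simp only: qpoch_double mult.commute[of q])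
  have dbl2: "qpoch (q ^ 2 * a ^ 2 / x) (q ^ 2) j * qpoch (q ^ 2 * a ^ 2 / (q * x)) (q ^ 2) j = qpoch (q * a ^ 2 / x) q (2 * j)" if "x \<noteq> 0" for x j
  proof -
    have e: "q ^ 2 * a ^ 2 / x = q * a ^ 2 / x * q" "q ^ 2 * a ^ 2 / (q * x) = q * a ^ 2 / x"
      using nz that by (simp_all add: power2_eq_square mult_ac)
    show ?thesis
      unfolding e qpoch_double by (rule mult.commute)
  qed
  have "qpochs (vwp_upper (a ^ 2) [b ^ 2, x, q * x, y, q * y, z, q * z] (q ^ 2)) (q ^ 2) j /
      qpochs (q ^ 2 # vwp_lower (a ^ 2) [b ^ 2, x, q * x, y, q * y, z, q * z] (q ^ 2)) (q ^ 2) j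
    = (1 - a ^ 2 * (q ^ 2) ^ (2 * j)) / (1 - a ^ 2) *
     (qpoch (a ^ 2) (q ^ 2) j * qpoch (b ^ 2) (q ^ 2) j /
       (qpoch (q ^ 2) (q ^ 2) j * qpoch (q ^ 2 * a ^ 2 / b ^ 2) (q ^ 2) j)) *
     (qpoch x q (2 * j) * qpoch y q (2 * j) * qpoch z q (2 * j) /
       (qpoch (q * a ^ 2 / x) q (2 * j) * qpoch (q * a ^ 2 / y) q (2 * j) * qpoch (q * a ^ 2 / z) q (2 * j)))" for j
    unfolding pair[symmetric] dbl[of x, symmetric] dbl[of y, symmetric] dbl[of z, symmetric] dbl2[OF nz(2), symmetric] dbl2[OF nz(3), symmetric] dbl2[OF nz(4), symmetric]
    by (simp add: vwp_upper_def vwp_lower_def qpochs_def s_def[symmetric] mult_ac)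
  then show "very_well_poised (a ^ 2) [b ^ 2, x, q * x, y, q * y, z, q * z] (q ^ 2) t
    = (\<Sum>j. (1 - a ^ 2 * (q ^ 2) ^ (2 * j)) *
     (qpoch (a ^ 2) (q ^ 2) j * qpoch (b ^ 2) (q ^ 2) j /
       (qpoch (q ^ 2) (q ^ 2) j * qpoch (q ^ 2 * a ^ 2 / b ^ 2) (q ^ 2) j)) *
     (qpoch x q (2 * j) * qpoch y q (2 * j) * qpoch z q (2 * j) /
       (qpoch (q * a ^ 2 / x) q (2 * j) * qpoch (q * a ^ 2 / y) q (2 * j) * qpoch (q * a ^ 2 / z) q (2 * j))) *
     t ^ j / (1 - a ^ 2))"
    unfolding very_well_poised_def basic_hypergeometric_def by (simp only:) (simp add: mult_ac)
qed


theorem theorem9p4: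
  fixes q a b x y z h sq sx sy sz :: complex and \<sigma> :: real
  assumes nonzero: "q \<noteq> 0" "a \<noteq> 0" "b \<noteq> 0" "x \<noteq> 0" "y \<noteq> 0" "z \<noteq> 0" "h \<noteq> 0"
    and q_lt_1: "norm q < 1"
    and conv: "norm (q ^ 3 * a ^ 6) < (norm (b * x * y * z)) ^ 2"
    and sigma_pos: "\<sigma> > 0"
    and roots: "sq ^ 2 = q" "sx ^ 2 = x" "sy ^ 2 = y" "sz ^ 2 = z"
    and series_denominators:
      "nonvanishing_denominators
         (vwp_lower (a ^ 2) [b ^ 2, x, q * x, y, q * y, z, q * z] (q ^ 2)) (q ^ 2)"
    and theta_denominators:
      "qtheta h q \<noteq> 0" "qtheta (h * (x * y * z / (q * a ^ 2))) q \<noteq> 0"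
    and factorial_denominators:
      "qpoch_inf (q * a / b) q \<noteq> 0" "qpoch_inf (- (q * a / b)) q \<noteq> 0"
      "qpoch_inf (q * a ^ 2 / x) q \<noteq> 0" "qpoch_inf (q * a ^ 2 / y) q \<noteq> 0"
      "qpoch_inf (q * a ^ 2 / z) q \<noteq> 0"
    and integrand_denominators:
      "norm (\<sigma> / a * (sx * sy * sz / sq)) < 1"
      "norm (\<sigma> * a * (sq / (sx * sy * sz))) < 1"
      "norm (a * (sq * sx / (sy * sz))) / \<sigma> < 1"
      "norm (a * (sq * sy / (sx * sz))) / \<sigma> < 1"
      "norm (a * (sq * sz / (sx * sy))) / \<sigma> < 1"
      "norm (q * a ^ 2 / (b * (sx * sy * sz))) / \<sigma> < 1"
  shows
    "very_well_poised (a ^ 2) [b ^ 2, x, q * x, y, q * y, z, q * z] (q ^ 2)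
       (q ^ 3 * a ^ 6 / (b * x * y * z) ^ 2)
     = qpochs_inf [q, q * a, - (q * a), x, y, z,
                   q * a ^ 2 / (x * y), q * a ^ 2 / (x * z), q * a ^ 2 / (y * z)] q
       / (2 * complex_of_real pi * qthetas [h, h * (x * y * z / (q * a ^ 2))] q
          * qpochs_inf [q * a / b, - (q * a / b), q * a ^ 2 / x, q * a ^ 2 / y, q * a ^ 2 / z] q)
       * integral {-pi..pi} (\<lambda>\<psi>. let w = cis \<psi> in
           qpochs_inf
             (scaled [h / a * (sx * sy * sz / sq), q * a / h * (sq / (sx * sy * sz))] (\<sigma> / w)
              @ scaled [h / a * (sx * sy * sz / sq), q * a / h * (sq / (sx * sy * sz)),
                        q * a ^ 2 / (sx * sy * sz), - (q * a ^ 2 / (sx * sy * sz)),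
                        sq ^ 3 * a ^ 3 / (b ^ 2 * (sx * sy * sz))] (w / \<sigma>)) q
           / qpochs_inf
             (scaled [1 / a * (sx * sy * sz / sq), a * (sq / (sx * sy * sz))] (\<sigma> / w)
              @ scaled [a * (sq * sx / (sy * sz)), a * (sq * sy / (sx * sz)),
                        a * (sq * sz / (sx * sy)),
                        q * a ^ 2 / (b * (sx * sy * sz)), - (q * a ^ 2 / (b * (sx * sy * sz)))]
                  (w / \<sigma>)) q)"
proof -
  define A where "A = 1 / a * (sx * sy * sz / sq)"
  define r where "r = 1 / \<sigma>"
  (* In terms of A, the numbers e and s are q^(1/2) a / A and q^(1/2) a / (b A). *)
  define e where "e = q * a ^ 2 / (sx * sy * sz)"
  define s where "s = q * a ^ 2 / (b * (sx * sy * sz))"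
  have nzr: "sq \<noteq> 0" "sx \<noteq> 0" "sy \<noteq> 0" "sz \<noteq> 0"
    using roots nonzero by auto
  have A0: "A \<noteq> 0"
    using nzr nonzero by (simp add: A_def)
  have Asq: "q * a ^ 2 * A ^ 2 = x * y * z"
    unfolding A_def roots[symmetric] using nzr nonzero by (simp add: power_mult_distrib power_divide)
  have A_inv: "a * (sq / (sx * sy * sz)) = 1 / A"
    unfolding A_def using nzr nonzero by simp
  have fA: "a * (sq * sx / (sy * sz)) = x / A" "a * (sq * sy / (sx * sz)) = y / A"
    "a * (sq * sz / (sx * sy)) = z / A"
    unfolding A_def roots[symmetric] using nzr nonzero by (simp_all add: power2_eq_square)
  have e2: "e ^ 2 = q * a ^ 2 / A ^ 2"
    unfolding A_def e_def roots[symmetric] using nzr nonzero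
    by (simp add: power_mult_distrib power_divide power2_eq_square)
  have s2: "s ^ 2 = q * a ^ 2 / (b ^ 2 * A ^ 2)"
    unfolding A_def s_def roots[symmetric] using nzr nonzero
    by (simp add: power_mult_distrib power_divide power2_eq_square mult_ac)
  have g: "sq ^ 3 * a ^ 3 / (b ^ 2 * (sx * sy * sz)) = q * a ^ 2 / (b ^ 2 * A)"
    unfolding A_def roots(1)[symmetric] using nzr nonzero by (simp add: power2_eq_square power3_eq_cube)
  have hA: "h / a * (sx * sy * sz / sq) = h * A" "q * a / h * (sq / (sx * sy * sz)) = q / (h * A)"
    unfolding A_def using nzr nonzero by simp_all
  have hA2: "h * (x * y * z / (q * a ^ 2)) = h * A ^ 2"
    using nonzero by (simp add: Asq[symmetric])
  have t: "q ^ 3 * a ^ 6 / (b * x * y * z) ^ 2 = q * a ^ 2 / (b ^ 2 * A ^ 4)"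
  proof -
    have eq: "(b * x * y * z) ^ 2 = b ^ 2 * (q * a ^ 2 * A ^ 2) ^ 2"
      unfolding Asq by (simp add: power_mult_distrib)
    show ?thesis
      unfolding eq using nonzero A0
      by (simp add: power2_eq_square power3_eq_cube power_numeral_reduce mult_ac)
  qed
  have p: "qpoch_inf (q ^ 2 * a ^ 2 / b ^ 2) (q ^ 2) = qpoch_inf (q * a / b) q * qpoch_inf (- (q * a / b)) q"
    using qpoch_inf_square[OF q_lt_1, of "q * a / b"] by (simp add: power_mult_distrib power_divide)
  have r0: "r > 0"
    using sigma_pos by (simp add: r_def)
  interpret quadratic_setup q a b x y z h A r
  proof
    show "norm A < r"
      using integrand_denominators(1) sigma_pos nonzero nzr
      by (simp add: A_def r_def norm_mult norm_divide field_simps)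
    show "norm (1 / A) < r"
      using integrand_denominators(2) sigma_pos nonzero nzr
      unfolding A_inv[symmetric] by (simp add: r_def norm_mult norm_divide field_simps)
    show "norm (x / A) * r < 1" "norm (y / A) * r < 1" "norm (z / A) * r < 1"
      using integrand_denominators(3-5) unfolding fA by (simp_all add: r_def)
    have "norm s * r < 1"
      using integrand_denominators(6) by (simp add: s_def r_def)
    then have "(norm s * r) ^ 2 < 1"
      using r0 by (simp add: power_less_one_iff)
    then show "norm (q * a ^ 2 / (b ^ 2 * A ^ 2)) * r ^ 2 < 1"
      by (simp add: s2[symmetric] norm_power power_mult_distrib)
  qed (use q_lt_1 nonzero A0 Asq r0 factorial_denominators p in auto)
  define I where "I = circle_mean r (\<lambda>u. qtheta (h * A * u) q * qtheta (h * A / u) q *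
       (qpoch_inf (e * u) q * qpoch_inf (- (e * u)) q * qpoch_inf (q * a ^ 2 / (b ^ 2 * A) * u) q) /
       (qpoch_inf (A / u) q * qpoch_inf (1 / A / u) q *
        (qpoch_inf (x / A * u) q * qpoch_inf (y / A * u) q * qpoch_inf (z / A * u) q * qpoch_inf (s * u) q * qpoch_inf (- (s * u)) q)))"
  have "(\<lambda>j. mean_const * vwp_term j) sums (qpoch_inf (a ^ 2) (q ^ 2) * I)"
  proof -
    have "circle_mean r (\<lambda>u. weight u * phi65 (a ^ 2) (q ^ 2) (1 / b ^ 2) (u / A) (u / (q * A)))
       = qpoch_inf (a ^ 2) (q ^ 2) * I"
      unfolding I_def circle_mean_cmult[symmetric] by (intro circle_mean_cong r0 weight_phi65 s2 e2)
    then show ?thesis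
      using vwp_term_sums by simp
  qed
  moreover have "mean_const \<noteq> 0"
    using theta_denominators(1) theta_denominators(2)[unfolded hA2] by (rule mean_const_nonzero)
  ultimately have "vwp_term sums (qpoch_inf (a ^ 2) (q ^ 2) * I / mean_const)"
    using sums_divide[of "\<lambda>j. mean_const * vwp_term j" _ mean_const] by simp
  then have "(\<lambda>j. vwp_term j / (1 - a ^ 2)) sums (qpoch_inf (a ^ 2) (q ^ 2) * I / mean_const / (1 - a ^ 2))"
    by (rule sums_divide)
  moreover have "very_well_poised (a ^ 2) [b ^ 2, x, q * x, y, q * y, z, q * z] (q ^ 2)
       (q ^ 3 * a ^ 6 / (b * x * y * z) ^ 2) = (\<Sum>j. vwp_term j / (1 - a ^ 2))"
    unfolding t very_well_poised_quadratic(1)[OF nonzero(1,4-6) series_denominators] vwp_term_def ..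
  moreover have "qpoch_inf (a ^ 2) (q ^ 2) = (1 - a ^ 2) * (qpoch_inf (q * a) q * qpoch_inf (- (q * a)) q)"
    using qpoch_inf_unfold[OF q2, of "a ^ 2"] qpoch_inf_square[OF q_lt_1, of "q * a"]
    by (simp add: power_mult_distrib mult.commute)
  moreover have "a ^ 2 \<noteq> 1"
    by (rule very_well_poised_quadratic(2)[OF nonzero(1,4-6) series_denominators])
  ultimately have "very_well_poised (a ^ 2) [b ^ 2, x, q * x, y, q * y, z, q * z] (q ^ 2)
       (q ^ 3 * a ^ 6 / (b * x * y * z) ^ 2) = qpoch_inf (q * a) q * qpoch_inf (- (q * a)) q * I / mean_const"
    by (simp add: sums_iff)
  moreover have "I = integral {-pi..pi} (\<lambda>\<psi>. let w = cis \<psi> in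
           qpochs_inf
             (scaled [h / a * (sx * sy * sz / sq), q * a / h * (sq / (sx * sy * sz))] (\<sigma> / w)
              @ scaled [h / a * (sx * sy * sz / sq), q * a / h * (sq / (sx * sy * sz)),
                        q * a ^ 2 / (sx * sy * sz), - (q * a ^ 2 / (sx * sy * sz)),
                        sq ^ 3 * a ^ 3 / (b ^ 2 * (sx * sy * sz))] (w / \<sigma>)) q
           / qpochs_inf
             (scaled [1 / a * (sx * sy * sz / sq), a * (sq / (sx * sy * sz))] (\<sigma> / w)
              @ scaled [a * (sq * sx / (sy * sz)), a * (sq * sy / (sx * sz)),
                        a * (sq * sz / (sx * sy)),
                        q * a ^ 2 / (b * (sx * sy * sz)), - (q * a ^ 2 / (b * (sx * sy * sz)))]
                  (w / \<sigma>)) q) / (2 * of_real pi)"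
    unfolding I_def circle_mean_def
  proof (intro arg_cong2[where f="(/)"] integral_cong refl)
    fix \<psi> :: real
    define w where "w = cis \<psi>"
    define u where "u = of_real r * w"
    have w: "w \<noteq> 0"
      by (simp add: w_def)
    have u: "w / \<sigma> = u" "\<sigma> / w = 1 / u"
      using w sigma_pos by (simp_all add: u_def r_def)
    have q1: "q / (h * A * u) = q / (h * A) * (1 / u)" "q / (h * A / u) = q / (h * A) * u"
      by simp_all
    show "qtheta (h * A * (of_real r * cis \<psi>)) q * qtheta (h * A / (of_real r * cis \<psi>)) q *
       (qpoch_inf (e * (of_real r * cis \<psi>)) q * qpoch_inf (- (e * (of_real r * cis \<psi>))) q * qpoch_inf (q * a ^ 2 / (b ^ 2 * A) * (of_real r * cis \<psi>)) q) /
       (qpoch_inf (A / (of_real r * cis \<psi>)) q * qpoch_inf (1 / A / (of_real r * cis \<psi>)) q *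
        (qpoch_inf (x / A * (of_real r * cis \<psi>)) q * qpoch_inf (y / A * (of_real r * cis \<psi>)) q * qpoch_inf (z / A * (of_real r * cis \<psi>)) q * qpoch_inf (s * (of_real r * cis \<psi>)) q * qpoch_inf (- (s * (of_real r * cis \<psi>))) q))
      = (let w = cis \<psi> in
           qpochs_inf
             (scaled [h / a * (sx * sy * sz / sq), q * a / h * (sq / (sx * sy * sz))] (\<sigma> / w)
              @ scaled [h / a * (sx * sy * sz / sq), q * a / h * (sq / (sx * sy * sz)),
                        q * a ^ 2 / (sx * sy * sz), - (q * a ^ 2 / (sx * sy * sz)),
                        sq ^ 3 * a ^ 3 / (b ^ 2 * (sx * sy * sz))] (w / \<sigma>)) q
           / qpochs_inf
             (scaled [1 / a * (sx * sy * sz / sq), a * (sq / (sx * sy * sz))] (\<sigma> / w)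
              @ scaled [a * (sq * sx / (sy * sz)), a * (sq * sy / (sx * sz)),
                        a * (sq * sz / (sx * sy)),
                        q * a ^ 2 / (b * (sx * sy * sz)), - (q * a ^ 2 / (b * (sx * sy * sz)))]
                  (w / \<sigma>)) q)"
      unfolding Let_def w_def[symmetric] u u_def[symmetric] hA A_inv fA g e_def[symmetric] s_def[symmetric]
        A_def[symmetric] qtheta_eq q1
      by (simp add: qpochs_inf_def scaled_def mult_ac)
  qed
  ultimately show ?thesis
    unfolding mean_const_def p hA2
    by (simp add: qpochs_inf_def qthetas_def mult_ac)
qed

end
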